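(* $(A,\ell)$-Path Packing, parameterized by the vertex cover number $\mathsf{vc}$ of the input graph, admits a kernel with $O(\mathsf{vc}^2)$ vertices.
   Context: For an undirected graph $G$ and $A\subseteq V(G)$, an $A$-path is a path in $G$ that starts and ends at two distinct vertices of $A$ and whose internal vertices all lie in $V(G)\setminus A$. The problem $(A,\ell)$-Path Packing takes as input an undirected graph $G$, a set $A\subseteq V(G)$ and integers $k,\ell$. It asks whether $G$ contains $k$ pairwise vertex-disjoint $A$-paths, each of length exactly $\ell$. The vertex cover number $\mathsf{vc}(G)$ is the minimum size of a set $S\subseteq V(G)$ such that every edge has an endpoint in $S$. A kernel is a polynomial-time algorithm that maps an instance to an equivalent instance of the same problem whose size is bounded by a computable function of the parameter; here, the number of vertices of the output graph is $O(\mathsf{vc})$ squared. *)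

theory Defs
  imports
    Complex_Main
    "HOL-Computational_Algebra.Polynomial"
    "HOL-Library.Landau_Symbols"
begin

section \<open>Graphs, \<open>A\<close>-paths and path packings\<close>

record 'a graph =
  verts :: "'a set"
  edges :: "'a set set"

definition simple_graph :: "'a graph \<Rightarrow> bool" where
  "simple_graph G \<longleftrightarrow> finite (verts G) \<and> (\<forall>e\<in>edges G. e \<subseteq> verts G \<and> card e = 2)"

definition is_path :: "'a graph \<Rightarrow> 'a list \<Rightarrow> bool" where
  "is_path G p \<longleftrightarrow> p \<noteq> [] \<and> distinct p \<and> set p \<subseteq> verts G
     \<and> successively (\<lambda>u v. {u, v} \<in> edges G) p"

text \<open>The length of a path is its number of edges.\<close>

definition path_length :: "'a list \<Rightarrow> nat" where
  "path_length p = length p - 1"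

definition internal_verts :: "'a list \<Rightarrow> 'a set" where
  "internal_verts p = set (butlast (tl p))"

definition is_A_path :: "'a graph \<Rightarrow> 'a set \<Rightarrow> 'a list \<Rightarrow> bool" where
  "is_A_path G A p \<longleftrightarrow> is_path G p \<and> hd p \<in> A \<and> last p \<in> A \<and> hd p \<noteq> last p
     \<and> internal_verts p \<subseteq> verts G - A"

definition has_path_packing :: "'a graph \<Rightarrow> 'a set \<Rightarrow> nat \<Rightarrow> nat \<Rightarrow> bool" where
  "has_path_packing G A k l \<longleftrightarrow>
     (\<exists>P. finite P \<and> card P = k
        \<and> (\<forall>p\<in>P. is_A_path G A p \<and> path_length p = l)
        \<and> pairwise (\<lambda>p q. set p \<inter> set q = {}) P)"

definition vertex_cover :: "'a graph \<Rightarrow> 'a set \<Rightarrow> bool" where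
  "vertex_cover G S \<longleftrightarrow> S \<subseteq> verts G \<and> (\<forall>e\<in>edges G. e \<inter> S \<noteq> {})"

definition vertex_cover_number :: "'a graph \<Rightarrow> nat" where
  "vertex_cover_number G = (LEAST n. \<exists>S. vertex_cover G S \<and> card S = n)"


section \<open>Model of computation\<close>

text \<open>
  Algorithms are programs of a WHILE language over binary trees, in the style of
  N. D. Jones, \<^emph>\<open>Computability and Complexity from a Programming Perspective\<close>.
  There are finitely many variables in each program, the only operations on data are
  construction and destruction of pairs, and the only test is whether a tree is a leaf.

  An assignment costs one plus the size of the assigned value, as if the value were copied
  without sharing. Hence the size of the store never exceeds the size of the input plus
  the time spent, so that (for instance) repeated doubling of a tree is charged for the
  exponential size of the result. With this cost measure the language and Turing machines
  simulate each other with polynomial overhead.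
\<close>

datatype tree = Leaf | Node tree tree

fun left :: "tree \<Rightarrow> tree" where
  "left Leaf = Leaf"
| "left (Node a b) = a"

fun right :: "tree \<Rightarrow> tree" where
  "right Leaf = Leaf"
| "right (Node a b) = b"

datatype expr = Var nat | LeafE | NodeE expr expr | LeftE expr | RightE expr

type_synonym store = "nat \<Rightarrow> tree"

fun eval_expr :: "expr \<Rightarrow> store \<Rightarrow> tree" where
  "eval_expr (Var x) s = s x"
| "eval_expr LeafE s = Leaf"
| "eval_expr (NodeE a b) s = Node (eval_expr a s) (eval_expr b s)"
| "eval_expr (LeftE a) s = left (eval_expr a s)"
| "eval_expr (RightE a) s = right (eval_expr a s)"

datatype com =
    Skip
  | Assign nat expr
  | Seq com com
  | If expr com com
  | While expr com

text \<open>
  \<open>exec c s t s'\<close>: started in store \<open>s\<close>, the program \<open>c\<close> halts in store \<open>s'\<close> after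
  time \<open>t\<close>. The generated function \<^const>\<open>size\<close> counts the inner nodes of a tree.
\<close>

inductive exec :: "com \<Rightarrow> store \<Rightarrow> nat \<Rightarrow> store \<Rightarrow> bool" where
  Skip: "exec Skip s 1 s"
| Assign: "exec (Assign x e) s (1 + size (eval_expr e s)) (s(x := eval_expr e s))"
| Seq: "exec c1 s t1 s' \<Longrightarrow> exec c2 s' t2 s'' \<Longrightarrow> exec (Seq c1 c2) s (t1 + t2) s''"
| IfTrue: "eval_expr e s \<noteq> Leaf \<Longrightarrow> exec c1 s t s' \<Longrightarrow> exec (If e c1 c2) s (1 + t) s'"
| IfFalse: "eval_expr e s = Leaf \<Longrightarrow> exec c2 s t s' \<Longrightarrow> exec (If e c1 c2) s (1 + t) s'"
| WhileFalse: "eval_expr e s = Leaf \<Longrightarrow> exec (While e c) s 1 s"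
| WhileTrue: "eval_expr e s \<noteq> Leaf \<Longrightarrow> exec c s t1 s' \<Longrightarrow> exec (While e c) s' t2 s'' \<Longrightarrow>
    exec (While e c) s (1 + t1 + t2) s''"

text \<open>Variable 0 holds the input and the output; all other variables are initially \<^const>\<open>Leaf\<close>.\<close>

definition computes :: "com \<Rightarrow> tree \<Rightarrow> tree \<Rightarrow> nat \<Rightarrow> bool" where
  "computes c x y t \<longleftrightarrow> (\<exists>s. exec c ((\<lambda>_. Leaf)(0 := x)) t s \<and> s 0 = y)"

definition poly_time_on :: "'i set \<Rightarrow> ('i \<Rightarrow> tree) \<Rightarrow> ('j \<Rightarrow> tree) \<Rightarrow> ('i \<Rightarrow> 'j) \<Rightarrow> bool" where
  "poly_time_on D enc_in enc_out f \<longleftrightarrow>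
     (\<exists>(c :: com) (p :: nat poly). \<forall>x\<in>D. \<exists>t. t \<le> poly p (size (enc_in x))
        \<and> computes c (enc_in x) (enc_out (f x)) t)"

fun enc_bool :: "bool \<Rightarrow> tree" where
  "enc_bool False = Leaf"
| "enc_bool True = Node Leaf Leaf"

fun enc_list :: "('i \<Rightarrow> tree) \<Rightarrow> 'i list \<Rightarrow> tree" where
  "enc_list enc [] = Leaf"
| "enc_list enc (x # xs) = Node (enc x) (enc_list enc xs)"

text \<open>Numbers are encoded in binary, least significant bit first.\<close>

fun bits :: "nat \<Rightarrow> bool list" where
  "bits n = (if n = 0 then [] else odd n # bits (n div 2))"

declare bits.simps [simp del]

definition enc_nat :: "nat \<Rightarrow> tree" where
  "enc_nat n = enc_list enc_bool (bits n)"

definition computable :: "(nat \<Rightarrow> nat) \<Rightarrow> bool" where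
  "computable g \<longleftrightarrow> (\<exists>c. \<forall>n. \<exists>t. computes c (enc_nat n) (enc_nat (g n)) t)"


section \<open>Parameterized problems and kernels\<close>

record 'i param_problem =
  instances :: "'i set"
  encoding :: "'i \<Rightarrow> tree"
  yes_instance :: "'i \<Rightarrow> bool"
  parameter :: "'i \<Rightarrow> nat"

definition kernelization :: "'i param_problem \<Rightarrow> ('i \<Rightarrow> 'i) \<Rightarrow> bool" where
  "kernelization Q K \<longleftrightarrow>
     poly_time_on (instances Q) (encoding Q) (encoding Q) K
     \<and> (\<forall>x\<in>instances Q. K x \<in> instances Q \<and> (yes_instance Q (K x) \<longleftrightarrow> yes_instance Q x))
     \<and> (\<exists>g. computable g \<and> (\<forall>x\<in>instances Q. size (encoding Q (K x)) \<le> g (parameter Q x)))"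


section \<open>The problem \<open>(A,l)\<close>-Path Packing\<close>

record pp_instance =
  pp_graph :: "nat graph"
  pp_A :: "nat set"
  pp_k :: nat
  pp_l :: nat

text \<open>
  As an input to an algorithm, a graph with \<open>n\<close> vertices has vertex set \<open>{..<n}\<close> and is given
  by its adjacency matrix; the set \<open>A\<close> is given by its characteristic vector.
\<close>

definition pp_instances :: "pp_instance set" where
  "pp_instances = {I. simple_graph (pp_graph I) \<and> (\<exists>n. verts (pp_graph I) = {..<n})
     \<and> pp_A I \<subseteq> verts (pp_graph I)}"

definition enc_pp :: "pp_instance \<Rightarrow> tree" where
  "enc_pp I =
     (let n = card (verts (pp_graph I)) in
      Node (enc_list (\<lambda>u. enc_list (\<lambda>v. enc_bool ({u, v} \<in> edges (pp_graph I))) [0..<n]) [0..<n])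
        (Node (enc_list (\<lambda>u. enc_bool (u \<in> pp_A I)) [0..<n])
          (Node (enc_nat (pp_k I)) (enc_nat (pp_l I)))))"

definition path_packing_by_vc :: "pp_instance param_problem" where
  "path_packing_by_vc =
     \<lparr> instances = pp_instances,
       encoding = enc_pp,
       yes_instance = (\<lambda>I. has_path_packing (pp_graph I) (pp_A I) (pp_k I) (pp_l I)),
       parameter = (\<lambda>I. vertex_cover_number (pp_graph I)) \<rparr>"

end

theory Submission imports Defs begin

text \<open>
  A maximal matching yields a vertex cover \<open>S\<close> with at most \<open>2 vc\<close> vertices. On an \<open>A\<close>-path, a vertex
  outside \<open>S\<close> is determined by its two neighbours on the path, which lie in \<open>S\<close> (one of them is missing at
  an end of the path); so a packing matches its vertices outside \<open>S\<close> injectively to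
  \<open>O(vc\<^sup>2)\<close> \<^emph>\<open>demands\<close>. A maximum matching of all demands into the vertices outside \<open>S\<close> covers
  a set \<open>W\<close> of \<open>O(vc\<^sup>2)\<close> vertices, and whatever set of demands can be matched at all can be matched
  into \<open>W\<close>. Hence every packing can be rerouted through \<open>S \<union> W\<close>, and the kernel is the graph induced
  on \<open>S \<union> W\<close>; if \<open>k\<close> or \<open>l\<close> is too long compared with \<open>S\<close>, only \<open>k = 0\<close> is solvable.

  The matching comes from an auction: each unmatched demand takes its cheapest adjacent vertex from
  the current holder and raises the price by one. Then a vertex is at most one dearer than any
  other vertex adjacent to its holder. As there are more price levels than demands, some level is empty.
  All vertices above this gap are held, by demands that have no vertex below it; every demand
  adjacent to a vertex below the gap holds a vertex below the gap.

  The polynomial-time list functions are closed under composition and bounded folds, so the algorithm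
  need only be written as a function in the logic.
\<close>


section \<open>Polynomially bounded functions\<close>

text \<open>The set \<open>W\<close> is fixed before any packing is known, so one matching has to do
  for every matchable set of demands. Correctness rests on this exchange property alone; that the
  matching is maximum is never stated. All vertices outside \<open>S\<close> can be replaced at once
  because they form an independent set: their neighbours on a path lie in \<open>S\<close> and stay
  in place. Since ends and inner vertices must keep their roles, a demand also records membership in
  \<open>A\<close>. This is the factor 2 in the \<open>2 * (length S + 1) ^ 2\<close> demands; the
  added 1 stands for a missing neighbour. An auction suits the programming language better than
  augmenting paths: it is a fold of one local step, with a number of rounds known in advance and a
  state that grows by a constant per round. The size of the output must be bounded in terms of the
  vertex cover number alone, and this includes the binary numbers \<open>k\<close> and
  \<open>l\<close>; hence instances in which one of them has many digits are answered
  outright.\<close>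

definition poly_bounded :: "(nat \<Rightarrow> nat) \<Rightarrow> bool" where
  "poly_bounded g \<longleftrightarrow> (\<exists>k. \<forall>n. g n \<le> (n + 2) ^ k)"

named_theorems poly_bounded_intros

lemma poly_bounded_power: "poly_bounded (\<lambda>n. (n + 2) ^ k)"
  unfolding poly_bounded_def by blast

text \<open>The shift by 2 keeps the base at least 2 even at \<open>n = 0\<close>, so that the
  exponent can absorb a constant.\<close>

lemma poly_bounded_const [poly_bounded_intros]: "poly_bounded (\<lambda>n. c)"
proof -
  have "c \<le> (n + 2) ^ c" for n
  proof -
    have "c \<le> 2 ^ c" by (simp add: less_imp_le)
    also have "\<dots> \<le> (n + 2) ^ c" by (intro power_mono) auto
    finally show ?thesis .
  qed
  then show ?thesis unfolding poly_bounded_def by blast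
qed

lemma poly_bounded_id [poly_bounded_intros]: "poly_bounded (\<lambda>n. n)"
  unfolding poly_bounded_def by (rule exI[of _ 1]) auto

lemma poly_bounded_mono: "poly_bounded g \<Longrightarrow> (\<And>n. f n \<le> g n) \<Longrightarrow> poly_bounded f"
  unfolding poly_bounded_def by (meson le_trans)

lemma poly_bounded_mult [poly_bounded_intros]:
  assumes "poly_bounded f" "poly_bounded g"
  shows "poly_bounded (\<lambda>n. f n * g n)"
proof -
  obtain j k where "\<And>n. f n \<le> (n + 2) ^ j" "\<And>n. g n \<le> (n + 2) ^ k"
    using assms unfolding poly_bounded_def by blast
  then have "f n * g n \<le> (n + 2) ^ (j + k)" for n
    by (simp add: power_add mult_mono)
  then show ?thesis unfolding poly_bounded_def by blast
qed

text \<open>A sum is at most the product of the successors, which leaves only products and the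
  addition of 1.\<close>

lemma poly_bounded_add [poly_bounded_intros]:
  assumes "poly_bounded f" "poly_bounded g"
  shows "poly_bounded (\<lambda>n. f n + g n)"
proof -
  have "poly_bounded (\<lambda>n. (f n + 1) * (g n + 1))"
  proof (rule poly_bounded_mult)
    have succ: "poly_bounded (\<lambda>n. h n + 1)" if h: "poly_bounded h" for h
    proof -
      obtain k where k: "\<And>n. h n \<le> (n + 2) ^ k"
        using h unfolding poly_bounded_def by auto
      show ?thesis
      proof (rule poly_bounded_mono)
        show "poly_bounded (\<lambda>n. 2 * (n + 2) ^ k)"
          by (intro poly_bounded_mult poly_bounded_const poly_bounded_power)
        have "1 \<le> (n + 2) ^ k" for n :: nat by (rule one_le_power) simp
        then show "h n + 1 \<le> 2 * (n + 2) ^ k" for n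
          using add_mono[OF k[of n]] unfolding mult_2 by blast
      qed
    qed
    show "poly_bounded (\<lambda>n. f n + 1)" "poly_bounded (\<lambda>n. g n + 1)" using assms succ by auto
  qed
  then show ?thesis by (rule poly_bounded_mono) simp
qed

lemma poly_bounded_pow [poly_bounded_intros]:
  assumes "poly_bounded f"
  shows "poly_bounded (\<lambda>n. f n ^ k)"
  by (induction k) (auto intro: poly_bounded_mult assms poly_bounded_const)

lemma poly_bounded_Suc [poly_bounded_intros]: "poly_bounded f \<Longrightarrow> poly_bounded (\<lambda>n. Suc (f n))"
  using poly_bounded_add[OF _ poly_bounded_const[of 1]] by simp

lemma poly_bounded_compose:
  assumes "poly_bounded f" "poly_bounded g"
  shows "poly_bounded (\<lambda>n. f (g n))"
proof -
  obtain k where k: "\<And>n. f n \<le> (n + 2) ^ k" using assms(1) unfolding poly_bounded_def by auto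
  have "poly_bounded (\<lambda>n. (g n + 2) ^ k)"
    by (intro poly_bounded_intros assms)
  then show ?thesis by (rule poly_bounded_mono) (rule k)
qed

section \<open>Polynomial-time functions on encodable types\<close>

class enc =
  fixes enc :: "'a \<Rightarrow> tree"

instantiation bool :: enc begin
definition enc_bool_eq [simp]: "enc = enc_bool"
instance ..
end

instantiation list :: (enc) enc begin
definition enc_list_eq [simp]: "enc = enc_list (enc :: 'a \<Rightarrow> tree)"
instance ..
end

instantiation prod :: (enc, enc) enc begin
definition enc_prod_eq [simp]: "enc x = Node (enc (fst x)) (enc (snd x))"
instance ..
end

text \<open>Unlike the binary numbers of an instance, numbers inside algorithms are in unary.\<close>

instantiation nat :: enc begin
primrec enc_nat where
  "enc_nat 0 = Leaf"
| "enc_nat (Suc n) = Node Leaf (enc_nat n)"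
instance ..
end

abbreviation esize :: "'a :: enc \<Rightarrow> nat" where
  "esize x \<equiv> size (enc x)"

text \<open>
  Register \<open>b\<close> holds the argument and the result, and the registers below \<open>b\<close> are preserved,
  so that a program with a larger \<open>b\<close> may serve as a subroutine.
\<close>

definition ptime :: "('a :: enc \<Rightarrow> 'b :: enc) \<Rightarrow> bool" where
  "ptime f \<longleftrightarrow> (\<exists>k. \<forall>b. \<exists>c. \<forall>s x. s b = enc x \<longrightarrow>
     (\<exists>t s'. exec c s t s' \<and> t \<le> (esize x + 2) ^ k \<and> s' b = enc (f x) \<and> (\<forall>i<b. s' i = s i)))"


lemma ptimeI:
  assumes "poly_bounded T"
    and "\<And>b s x. s b = enc x \<Longrightarrow> \<exists>t s'. exec (C b) s t s' \<and> t \<le> T (esize x)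
      \<and> s' b = enc (f x) \<and> (\<forall>i<b. s' i = s i)"
  shows "ptime f"
proof -
  obtain k where "\<And>n. T n \<le> (n + 2) ^ k" using assms(1) unfolding poly_bounded_def by auto
  then show ?thesis unfolding ptime_def using assms(2) by (meson order_trans)
qed

text \<open>The exponent in \<open>ptime\<close> does not depend on \<open>b\<close>, so choice over
  \<open>b\<close> gives one family \<open>C\<close> of programs under a common bound. Monotonicity
  of \<open>T\<close> is for calls on arguments whose size is only known from above.\<close>

lemma ptimeE:
  assumes "ptime f"
  obtains T C where "mono T" "poly_bounded T"
    and "\<And>b s x. s b = enc x \<Longrightarrow> \<exists>t s'. exec (C b) s t s' \<and> t \<le> T (esize x)
      \<and> s' b = enc (f x) \<and> (\<forall>i<b. s' i = s i)"
proof -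
  obtain k where "\<forall>b. \<exists>c. \<forall>s x. s b = enc x \<longrightarrow>
     (\<exists>t s'. exec c s t s' \<and> t \<le> (esize x + 2) ^ k \<and> s' b = enc (f x) \<and> (\<forall>i<b. s' i = s i))"
    using assms unfolding ptime_def by blast
  from choice[OF this] obtain C where "\<forall>b s x. s b = enc x \<longrightarrow>
     (\<exists>t s'. exec (C b) s t s' \<and> t \<le> (esize x + 2) ^ k \<and> s' b = enc (f x) \<and> (\<forall>i<b. s' i = s i))"
    by (rule exE)
  moreover have "mono (\<lambda>n :: nat. (n + 2) ^ k)" by (intro monoI power_mono) auto
  ultimately show thesis
    using that[of "\<lambda>n. (n + 2) ^ k" C] poly_bounded_power[of k] by simp
qed

lemma exec_size: "exec c s t s' \<Longrightarrow> size (s' i) \<le> size (s i) + t"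
  by (induction rule: exec.induct) auto

text \<open>An assignment is charged the size of the value, so a time bound is also a bound on the
  size of the result.\<close>

lemma ptime_size:
  assumes "ptime f"
  obtains g where "mono g" "poly_bounded g" "\<And>x. esize (f x) \<le> g (esize x)"
proof -
  obtain T C where T: "mono T" "poly_bounded T"
    and C: "\<And>b s x. s b = enc x \<Longrightarrow> \<exists>t s'. exec (C b) s t s' \<and> t \<le> T (esize x)
      \<and> s' b = enc (f x) \<and> (\<forall>i<b. s' i = s i)"
    by (rule ptimeE[OF assms]) (rule that)
  have "esize (f x) \<le> esize x + T (esize x)" for x
  proof -
    obtain t s' where "exec (C 0) (\<lambda>_. enc x) t s'" "t \<le> T (esize x)" "s' 0 = enc (f x)"
      using C[of "\<lambda>_. enc x" 0 x] by blast
    then show ?thesis using exec_size[of "C 0" "\<lambda>_. enc x" t s' 0] by simp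
  qed
  moreover have "mono (\<lambda>n. n + T n)" using T(1) by (auto simp: mono_def intro: add_mono)
  ultimately show thesis
    using that[of "\<lambda>n. n + T n"] poly_bounded_add[OF poly_bounded_id T(2)] by simp
qed

section \<open>Closure under straight-line programs and branching\<close>

named_theorems ptime_intros

text \<open>Conversions between types with equal trees cost nothing: a pair of head and tail is
  already the list, and a unary number is already a list of \<open>False\<close>.\<close>

lemma ptime_same_enc:
  assumes "\<And>x. enc (f x) = enc x"
  shows "ptime f"
proof (rule ptimeI[where C = "\<lambda>b. Skip", OF poly_bounded_const[of 1]])
  fix b :: nat and s and x :: 'a
  assume "s b = enc x"
  then show "\<exists>t s'. exec Skip s t s' \<and> t \<le> 1 \<and> s' b = enc (f x) \<and> (\<forall>i<b. s' i = s i)"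
    using exec.Skip[of s] assms by (intro exI[of _ 1] exI[of _ s]) simp
qed

lemma ptime_id [ptime_intros]: "ptime (\<lambda>x. x)"
  by (rule ptime_same_enc) simp

lemma ptime_assign:
  assumes "\<And>b s x. s b = enc x \<Longrightarrow> eval_expr (e b) s = enc (f x)"
    and "poly_bounded T" "\<And>x. esize (f x) \<le> T (esize x)"
  shows "ptime f"
proof (rule ptimeI[where C = "\<lambda>b. Assign b (e b)" and T = "\<lambda>n. Suc (T n)"])
  fix b :: nat and s and x :: 'a
  assume "s b = enc x"
  with assms(1) have "eval_expr (e b) s = enc (f x)" by blast
  with exec.Assign[of b "e b" s] have "exec (Assign b (e b)) s (Suc (esize (f x))) (s(b := enc (f x)))" by simp
  with assms(3)[of x]
  show "\<exists>t s'. exec (Assign b (e b)) s t s' \<and> t \<le> Suc (T (esize x)) \<and> s' b = enc (f x) \<and> (\<forall>i<b. s' i = s i)"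
    by (intro exI[of _ "Suc (esize (f x))"] exI[of _ "s(b := enc (f x))"]) simp
qed (intro poly_bounded_intros assms)

lemma ptime_comp:
  fixes f :: "'a :: enc \<Rightarrow> 'b :: enc" and g :: "'b \<Rightarrow> 'c :: enc"
  assumes "ptime g" "ptime f"
  shows "ptime (\<lambda>x. g (f x))"
proof -
  obtain T C where T: "mono T" "poly_bounded T"
    and C: "\<And>b s x. s b = enc x \<Longrightarrow> \<exists>t s'. exec (C b) s t s' \<and> t \<le> T (esize x)
      \<and> s' b = enc (f x) \<and> (\<forall>i<b. s' i = s i)"
    by (rule ptimeE[OF assms(2)]) (rule that)
  obtain U D where U: "mono U" "poly_bounded U"
    and D: "\<And>b s x. s b = enc x \<Longrightarrow> \<exists>t s'. exec (D b) s t s' \<and> t \<le> U (esize x)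
      \<and> s' b = enc (g x) \<and> (\<forall>i<b. s' i = s i)"
    by (rule ptimeE[OF assms(1)]) (rule that)
  obtain h where h: "mono h" "poly_bounded h" "\<And>x. esize (f x) \<le> h (esize x)"
    by (rule ptime_size[OF assms(2)]) (rule that)
  show ?thesis
  proof (rule ptimeI[where C = "\<lambda>b. Seq (C b) (D b)" and T = "\<lambda>n. T n + U (h n)"])
    fix b :: nat and s and x :: 'a
    assume "s b = enc x"
    then obtain t s' where 1: "exec (C b) s t s'" "t \<le> T (esize x)" "s' b = enc (f x)" "\<forall>i<b. s' i = s i"
      using C by blast
    then obtain u s'' where 2: "exec (D b) s' u s''" "u \<le> U (esize (f x))" "s'' b = enc (g (f x))" "\<forall>i<b. s'' i = s' i"
      using D by blast
    have "u \<le> U (h (esize x))" using 2(2) h(3) U(1) by (meson monoD order_trans)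
    then have "exec (Seq (C b) (D b)) s (t + u) s''" "t + u \<le> T (esize x) + U (h (esize x))"
      using 1 2 by (auto intro: exec.Seq)
    then show "\<exists>t s'. exec (Seq (C b) (D b)) s t s' \<and> t \<le> T (esize x) + U (h (esize x))
        \<and> s' b = enc (g (f x)) \<and> (\<forall>i<b. s' i = s i)"
      using 1(4) 2(3,4) by (intro exI[of _ "t + u"] exI[of _ s'']) simp
  qed (intro poly_bounded_add T poly_bounded_compose[OF U(2) h(2)])
qed

primrec quote :: "tree \<Rightarrow> expr" where
  "quote Leaf = LeafE"
| "quote (Node a b) = NodeE (quote a) (quote b)"

lemma eval_quote [simp]: "eval_expr (quote t) s = t"
  by (induction t) auto

lemma ptime_const [ptime_intros]: "ptime (\<lambda>x. c)"
  by (rule ptime_assign[where e = "\<lambda>b. quote (enc c)", OF _ poly_bounded_const]) auto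

lemma ptime_fst [ptime_intros]: "ptime f \<Longrightarrow> ptime (\<lambda>x. fst (f x))"
  by (rule ptime_comp[of fst], rule ptime_assign[where e = "\<lambda>b. LeftE (Var b)", OF _ poly_bounded_id]) auto

lemma ptime_snd [ptime_intros]: "ptime f \<Longrightarrow> ptime (\<lambda>x. snd (f x))"
  by (rule ptime_comp[of snd], rule ptime_assign[where e = "\<lambda>b. RightE (Var b)", OF _ poly_bounded_id]) auto

lemma ptime_tl [ptime_intros]:
  fixes f :: "'a :: enc \<Rightarrow> 'b :: enc list"
  shows "ptime f \<Longrightarrow> ptime (\<lambda>x. tl (f x))"
proof (rule ptime_comp[of tl], rule ptime_assign[where e = "\<lambda>b. RightE (Var b)", OF _ poly_bounded_id])
  fix xs :: "'b list"
  show "esize (tl xs) \<le> esize xs" by (cases xs) auto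
  show "eval_expr (RightE (Var b)) s = enc (tl xs)" if "s b = enc xs" for b s
    using that by (cases xs) auto
qed

lemma ptime_pred [ptime_intros]: "ptime f \<Longrightarrow> ptime (\<lambda>x. f x - Suc 0)"
proof (rule ptime_comp[of "\<lambda>n. n - Suc 0"], rule ptime_assign[where e = "\<lambda>b. RightE (Var b)", OF _ poly_bounded_id])
  fix n :: nat
  show "esize (n - Suc 0) \<le> esize n" by (cases n) auto
  show "eval_expr (RightE (Var b)) s = enc (n - Suc 0)" if "s b = enc n" for b s
    using that by (cases n) auto
qed

lemma ptime_Suc [ptime_intros]: "ptime f \<Longrightarrow> ptime (\<lambda>x. Suc (f x))"
  by (rule ptime_comp[of Suc], rule ptime_assign[where e = "\<lambda>b. NodeE LeafE (Var b)" and T = Suc])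
    (auto intro: poly_bounded_intros)

lemma ptime_Pair [ptime_intros]:
  assumes "ptime f" "ptime g"
  shows "ptime (\<lambda>x. (f x, g x))"
proof -
  obtain T C where T: "mono T" "poly_bounded T"
    and C: "\<And>b s x. s b = enc x \<Longrightarrow> \<exists>t s'. exec (C b) s t s' \<and> t \<le> T (esize x)
      \<and> s' b = enc (f x) \<and> (\<forall>i<b. s' i = s i)"
    by (rule ptimeE[OF assms(1)]) (rule that)
  obtain U D where U: "mono U" "poly_bounded U"
    and D: "\<And>b s x. s b = enc x \<Longrightarrow> \<exists>t s'. exec (D b) s t s' \<and> t \<le> U (esize x)
      \<and> s' b = enc (g x) \<and> (\<forall>i<b. s' i = s i)"
    by (rule ptimeE[OF assms(2)]) (rule that)
  obtain h where h: "mono h" "poly_bounded h" "\<And>x. esize (f x) \<le> h (esize x)"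
    by (rule ptime_size[OF assms(1)]) (rule that)
  obtain l where l: "mono l" "poly_bounded l" "\<And>x. esize (g x) \<le> l (esize x)"
    by (rule ptime_size[OF assms(2)]) (rule that)
  \<comment> \<open>The argument stays in register \<open>b\<close> while \<open>C\<close> works
    from \<open>Suc b\<close> on. \<open>D\<close> works one register higher still, so the result of
    \<open>C\<close> survives it.\<close>
  let ?P = "\<lambda>b. Seq (Assign (Suc b) (Var b)) (Seq (C (Suc b)) (Seq (Assign (Suc (Suc b)) (Var b))
    (Seq (D (Suc (Suc b))) (Assign b (NodeE (Var (Suc b)) (Var (Suc (Suc b))))))))"
  let ?B = "\<lambda>n. 1 + n + (T n + (1 + n + (U n + (2 + h n + l n))))"
  show ?thesis
  proof (rule ptimeI[where C = ?P and T = ?B])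
    fix b :: nat and s and x :: 'a
    assume b: "s b = enc x"
    define s1 where "s1 = s(Suc b := enc x)"
    have 1: "exec (Assign (Suc b) (Var b)) s (1 + esize x) s1"
      using exec.Assign[of "Suc b" "Var b" s] b by (simp add: s1_def)
    obtain t2 s2 where 2: "exec (C (Suc b)) s1 t2 s2" "t2 \<le> T (esize x)" "s2 (Suc b) = enc (f x)"
      "\<forall>i<Suc b. s2 i = s1 i"
      using C[of s1 "Suc b" x] unfolding s1_def by auto
    define s3 where "s3 = s2(Suc (Suc b) := enc x)"
    have "s2 b = enc x" using 2 b by (simp add: s1_def)
    then have 3: "exec (Assign (Suc (Suc b)) (Var b)) s2 (1 + esize x) s3"
      using exec.Assign[of "Suc (Suc b)" "Var b" s2] by (simp add: s3_def)
    obtain t4 s4 where 4: "exec (D (Suc (Suc b))) s3 t4 s4" "t4 \<le> U (esize x)" "s4 (Suc (Suc b)) = enc (g x)"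
      "\<forall>i<Suc (Suc b). s4 i = s3 i"
      using D[of s3 "Suc (Suc b)" x] unfolding s3_def by auto
    have "s4 (Suc b) = enc (f x)" using 4 2 by (simp add: s3_def)
    then have 5: "exec (Assign b (NodeE (Var (Suc b)) (Var (Suc (Suc b))))) s4 (1 + esize (f x, g x)) (s4(b := enc (f x, g x)))"
      using exec.Assign[of b "NodeE (Var (Suc b)) (Var (Suc (Suc b)))" s4] 4 by simp
    let ?t = "1 + esize x + (t2 + (1 + esize x + (t4 + (1 + esize (f x, g x)))))"
    have "exec (?P b) s ?t (s4(b := enc (f x, g x)))"
      by (intro exec.Seq[OF 1] exec.Seq[OF 2(1)] exec.Seq[OF 3] exec.Seq[OF 4(1)] 5)
    moreover have "?t \<le> ?B (esize x)" using 2 4 h(3)[of x] l(3)[of x] by simp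
    moreover have "\<forall>i<b. (s4(b := enc (f x, g x))) i = s i"
      using 2 4 by (simp add: s3_def s1_def)
    ultimately show "\<exists>t s'. exec (?P b) s t s' \<and> t \<le> ?B (esize x) \<and> s' b = enc (f x, g x) \<and> (\<forall>i<b. s' i = s i)"
      by (intro exI[of _ ?t] exI[of _ "s4(b := enc (f x, g x))"]) simp
  qed (intro poly_bounded_intros T U h l)
qed

lemma ptime_Cons [ptime_intros]:
  assumes "ptime f" "ptime g"
  shows "ptime (\<lambda>x. f x # g x)"
proof -
  have "ptime (\<lambda>p :: 'b \<times> 'b list. fst p # snd p)"
    by (rule ptime_same_enc) simp
  from ptime_comp[OF this ptime_Pair[OF assms]] show ?thesis by simp
qed

lemma ptime_if [ptime_intros]:
  assumes "ptime p" "ptime f" "ptime g"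
  shows "ptime (\<lambda>x. if p x then f x else g x)"
proof -
  obtain R E where R: "mono R" "poly_bounded R"
    and E: "\<And>b s x. s b = enc x \<Longrightarrow> \<exists>t s'. exec (E b) s t s' \<and> t \<le> R (esize x)
      \<and> s' b = enc (p x) \<and> (\<forall>i<b. s' i = s i)"
    by (rule ptimeE[OF assms(1)]) (rule that)
  obtain T C where T: "mono T" "poly_bounded T"
    and C: "\<And>b s x. s b = enc x \<Longrightarrow> \<exists>t s'. exec (C b) s t s' \<and> t \<le> T (esize x)
      \<and> s' b = enc (f x) \<and> (\<forall>i<b. s' i = s i)"
    by (rule ptimeE[OF assms(2)]) (rule that)
  obtain U D where U: "mono U" "poly_bounded U"
    and D: "\<And>b s x. s b = enc x \<Longrightarrow> \<exists>t s'. exec (D b) s t s' \<and> t \<le> U (esize x)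
      \<and> s' b = enc (g x) \<and> (\<forall>i<b. s' i = s i)"
    by (rule ptimeE[OF assms(3)]) (rule that)
  let ?P = "\<lambda>b. Seq (Assign (Suc b) (Var b)) (Seq (E (Suc b)) (If (Var (Suc b)) (C b) (D b)))"
  let ?B = "\<lambda>n. 1 + n + (R n + (1 + T n + U n))"
  show ?thesis
  proof (rule ptimeI[where C = ?P and T = ?B])
    fix b :: nat and s and x :: 'a
    assume b: "s b = enc x"
    define s1 where "s1 = s(Suc b := enc x)"
    have 1: "exec (Assign (Suc b) (Var b)) s (1 + esize x) s1"
      using exec.Assign[of "Suc b" "Var b" s] b by (simp add: s1_def)
    obtain t2 s2 where 2: "exec (E (Suc b)) s1 t2 s2" "t2 \<le> R (esize x)" "s2 (Suc b) = enc (p x)"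
      "\<forall>i<Suc b. s2 i = s1 i"
      using E[of s1 "Suc b" x] unfolding s1_def by auto
    have s2: "s2 b = enc x" using 2 b by (simp add: s1_def)
    have "\<exists>t s'. exec (If (Var (Suc b)) (C b) (D b)) s2 t s' \<and> t \<le> 1 + T (esize x) + U (esize x)
      \<and> s' b = enc (if p x then f x else g x) \<and> (\<forall>i<b. s' i = s2 i)"
    proof (cases "p x")
      case True
      then have nz: "eval_expr (Var (Suc b)) s2 \<noteq> Leaf" using 2 by simp
      obtain t s' where "exec (C b) s2 t s'" "t \<le> T (esize x)" "s' b = enc (f x)" "\<forall>i<b. s' i = s2 i"
        using C[of s2 b x, OF s2] by blast
      then show ?thesis using exec.IfTrue[OF nz, of "C b" t s' "D b"] True
        by (intro exI[of _ "1 + t"] exI[of _ s']) simp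
    next
      case False
      then have z: "eval_expr (Var (Suc b)) s2 = Leaf" using 2 by simp
      obtain t s' where "exec (D b) s2 t s'" "t \<le> U (esize x)" "s' b = enc (g x)" "\<forall>i<b. s' i = s2 i"
        using D[of s2 b x, OF s2] by blast
      then show ?thesis using exec.IfFalse[OF z, of "D b" t s' "C b"] False
        by (intro exI[of _ "1 + t"] exI[of _ s']) simp
    qed
    then obtain t3 s3 where 3: "exec (If (Var (Suc b)) (C b) (D b)) s2 t3 s3" "t3 \<le> 1 + T (esize x) + U (esize x)"
      "s3 b = enc (if p x then f x else g x)" "\<forall>i<b. s3 i = s2 i" by blast
    have "exec (?P b) s (1 + esize x + (t2 + t3)) s3"
      by (intro exec.Seq[OF 1] exec.Seq[OF 2(1)] 3(1))
    moreover have "1 + esize x + (t2 + t3) \<le> ?B (esize x)" using 2(2) 3(2) by simp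
    moreover have "\<forall>i<b. s3 i = s i" using 2 3 by (simp add: s1_def)
    ultimately show "\<exists>t s'. exec (?P b) s t s' \<and> t \<le> ?B (esize x)
      \<and> s' b = enc (if p x then f x else g x) \<and> (\<forall>i<b. s' i = s i)"
      using 3(3) by (intro exI[of _ "1 + esize x + (t2 + t3)"] exI[of _ s3]) simp
  qed (intro poly_bounded_intros R T U)
qed

lemma ptime_case_list:
  fixes l :: "'a :: enc \<Rightarrow> 'b :: enc list"
  assumes "ptime l" "ptime f" "ptime (\<lambda>p. g (fst p) (fst (snd p)) (snd (snd p)))"
  shows "ptime (\<lambda>x. case l x of [] \<Rightarrow> f x | y # ys \<Rightarrow> g x y ys)"
proof -
  obtain R E where R: "mono R" "poly_bounded R"
    and E: "\<And>b s x. s b = enc x \<Longrightarrow> \<exists>t s'. exec (E b) s t s' \<and> t \<le> R (esize x)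
      \<and> s' b = enc (l x) \<and> (\<forall>i<b. s' i = s i)"
    by (rule ptimeE[OF assms(1)]) (rule that)
  obtain T C where T: "mono T" "poly_bounded T"
    and C: "\<And>b s x. s b = enc x \<Longrightarrow> \<exists>t s'. exec (C b) s t s' \<and> t \<le> T (esize x)
      \<and> s' b = enc (f x) \<and> (\<forall>i<b. s' i = s i)"
    by (rule ptimeE[OF assms(2)]) (rule that)
  obtain U D where U: "mono U" "poly_bounded U"
    and D: "\<And>b s p. s b = enc p \<Longrightarrow> \<exists>t s'. exec (D b) s t s' \<and> t \<le> U (esize p)
      \<and> s' b = enc (g (fst p) (fst (snd p)) (snd (snd p))) \<and> (\<forall>i<b. s' i = s i)"
    by (rule ptimeE[OF assms(3)]) (rule that)
  obtain h where h: "mono h" "poly_bounded h" "\<And>x. esize (l x) \<le> h (esize x)"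
    by (rule ptime_size[OF assms(1)]) (rule that)
  let ?I = "\<lambda>b. If (Var (Suc b)) (Seq (Assign b (NodeE (Var b) (Var (Suc b)))) (D b)) (C b)"
  let ?P = "\<lambda>b. Seq (Assign (Suc b) (Var b)) (Seq (E (Suc b)) (?I b))"
  let ?J = "\<lambda>n. 3 + n + h n + T n + U (1 + n + h n)"
  let ?B = "\<lambda>n. 1 + n + (R n + ?J n)"
  let ?r = "\<lambda>x. case l x of [] \<Rightarrow> f x | y # ys \<Rightarrow> g x y ys"
  show ?thesis
  proof (rule ptimeI[where C = ?P and T = ?B])
    fix b :: nat and s and x :: 'a
    assume b: "s b = enc x"
    define s1 where "s1 = s(Suc b := enc x)"
    have 1: "exec (Assign (Suc b) (Var b)) s (1 + esize x) s1"
      using exec.Assign[of "Suc b" "Var b" s] b by (simp add: s1_def)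
    obtain t2 s2 where 2: "exec (E (Suc b)) s1 t2 s2" "t2 \<le> R (esize x)" "s2 (Suc b) = enc (l x)"
      "\<forall>i<Suc b. s2 i = s1 i"
      using E[of s1 "Suc b" x] unfolding s1_def by auto
    have s2: "s2 b = enc x" using 2 b by (simp add: s1_def)
    have "\<exists>t s'. exec (?I b) s2 t s' \<and> t \<le> ?J (esize x) \<and> s' b = enc (?r x) \<and> (\<forall>i<b. s' i = s2 i)"
    proof (cases "l x")
      case Nil
      then have z: "eval_expr (Var (Suc b)) s2 = Leaf" using 2 by simp
      obtain t s' where "exec (C b) s2 t s'" "t \<le> T (esize x)" "s' b = enc (f x)" "\<forall>i<b. s' i = s2 i"
        using C[of s2 b x, OF s2] by blast
      then show ?thesis using exec.IfFalse[OF z, of "C b" t s'] Nil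
        by (intro exI[of _ "1 + t"] exI[of _ s']) simp
    next
      case (Cons y ys)
      then have nz: "eval_expr (Var (Suc b)) s2 \<noteq> Leaf" using 2 by simp
      let ?p = "(x, y, ys)"
      \<comment> \<open>A nonempty list \<open>y # ys\<close> and the pair \<open>(y, ys)\<close>
        are the same tree, so the branch for a nonempty list needs no destructuring.\<close>
      have p: "Node (s2 b) (s2 (Suc b)) = enc ?p" using 2 s2 Cons by simp
      have a: "exec (Assign b (NodeE (Var b) (Var (Suc b)))) s2 (1 + esize ?p) (s2(b := enc ?p))"
        using exec.Assign[of b "NodeE (Var b) (Var (Suc b))" s2] p by simp
      obtain t s' where D': "exec (D b) (s2(b := enc ?p)) t s'" "t \<le> U (esize ?p)"
        "s' b = enc (g x y ys)" "\<forall>i<b. s' i = (s2(b := enc ?p)) i"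
        using D[of "s2(b := enc ?p)" b ?p] by auto
      have e: "esize ?p \<le> 1 + esize x + h (esize x)" using h(3)[of x] Cons by simp
      then have "U (esize ?p) \<le> U (1 + esize x + h (esize x))" using U(1) by (rule monoD[rotated])
      then have t: "1 + (1 + esize ?p + t) \<le> ?J (esize x)" using e D'(2) by linarith
      have "exec (?I b) s2 (1 + (1 + esize ?p + t)) s'"
        by (rule exec.IfTrue[OF nz exec.Seq[OF a D'(1)]])
      then show ?thesis using t D'(3,4) Cons
        by (intro exI[of _ "1 + (1 + esize ?p + t)"] exI[of _ s']) (simp only: list.case fun_upd_def, simp)
    qed
    then obtain t3 s3 where 3: "exec (?I b) s2 t3 s3" "t3 \<le> ?J (esize x)"
      "s3 b = enc (?r x)" "\<forall>i<b. s3 i = s2 i" by blast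
    have "exec (?P b) s (1 + esize x + (t2 + t3)) s3"
      by (intro exec.Seq[OF 1] exec.Seq[OF 2(1)] 3(1))
    moreover have "1 + esize x + (t2 + t3) \<le> ?B (esize x)" using 2(2) 3(2) by simp
    moreover have "\<forall>i<b. s3 i = s i" using 2 3 by (simp add: s1_def)
    ultimately show "\<exists>t s'. exec (?P b) s t s' \<and> t \<le> ?B (esize x) \<and> s' b = enc (?r x) \<and> (\<forall>i<b. s' i = s i)"
      using 3(3) by (intro exI[of _ "1 + esize x + (t2 + t3)"] exI[of _ s3]) simp
  qed (intro poly_bounded_intros R T poly_bounded_compose[OF U(2)] h)
qed


text \<open>Polynomial steps alone do not make a loop polynomial, since each round might square the
  accumulator. With every partial result bounded by \<open>B\<close>, all rounds have a common cost
  bound.\<close>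

lemma ptime_foldl_bounded:
  fixes g :: "'a :: enc \<Rightarrow> 'c :: enc \<Rightarrow> 'b :: enc \<Rightarrow> 'c"
  assumes "ptime xs" "ptime init" "ptime (\<lambda>p. g (fst p) (fst (snd p)) (snd (snd p)))"
    and B: "poly_bounded B"
    and bound: "\<And>x i. i \<le> length (xs x) \<Longrightarrow> esize (foldl (g x) (init x) (take i (xs x))) \<le> B (esize x)"
  shows "ptime (\<lambda>x. foldl (g x) (init x) (xs x))"
proof -
  obtain R E where R: "mono R" "poly_bounded R"
    and E: "\<And>b s x. s b = enc x \<Longrightarrow> \<exists>t s'. exec (E b) s t s' \<and> t \<le> R (esize x)
      \<and> s' b = enc (xs x) \<and> (\<forall>i<b. s' i = s i)"
    by (rule ptimeE[OF assms(1)]) (rule that)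
  obtain U D where U: "mono U" "poly_bounded U"
    and D: "\<And>b s x. s b = enc x \<Longrightarrow> \<exists>t s'. exec (D b) s t s' \<and> t \<le> U (esize x)
      \<and> s' b = enc (init x) \<and> (\<forall>i<b. s' i = s i)"
    by (rule ptimeE[OF assms(2)]) (rule that)
  obtain T C where T: "mono T" "poly_bounded T"
    and C: "\<And>b s p. s b = enc p \<Longrightarrow> \<exists>t s'. exec (C b) s t s' \<and> t \<le> T (esize p)
      \<and> s' b = enc (g (fst p) (fst (snd p)) (snd (snd p))) \<and> (\<forall>i<b. s' i = s i)"
    by (rule ptimeE[OF assms(3)]) (rule that)
  obtain h where h: "mono h" "poly_bounded h" "\<And>x. esize (xs x) \<le> h (esize x)"
    by (rule ptime_size[OF assms(1)]) (rule that)
  \<comment> \<open>Register \<open>b\<close> keeps \<open>x\<close>, \<open>b + 1\<close> the rest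
    of the list, \<open>b + 2\<close> the accumulator, and \<open>b + 3\<close> serves the call of
    \<open>C\<close>. The bound \<open>?Q\<close> adds up one round: the loop test, three
    assignments, and \<open>C\<close> on a triple of size at most
    \<open>2 + n + B n + h n\<close>.\<close>
  let ?body = "\<lambda>b. Seq (Assign (b + 3) (NodeE (Var b) (NodeE (Var (b + 2)) (LeftE (Var (b + 1))))))
    (Seq (C (b + 3)) (Seq (Assign (b + 2) (Var (b + 3))) (Assign (b + 1) (RightE (Var (b + 1))))))"
  let ?W = "\<lambda>b. While (Var (b + 1)) (?body b)"
  let ?Q = "\<lambda>n. 6 + n + 2 * B n + 2 * h n + T (2 + n + B n + h n)"
  have loop: "\<exists>t s'. exec (?W b) s t s' \<and> t \<le> 1 + length ys * ?Q (esize x)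
      \<and> s' (b + 2) = enc (foldl (g x) acc ys) \<and> (\<forall>i\<le>b. s' i = s i)"
    if "s b = enc x" "s (b + 1) = enc ys" "s (b + 2) = enc acc" "esize ys \<le> h (esize x)"
      "\<And>i. i \<le> length ys \<Longrightarrow> esize (foldl (g x) acc (take i ys)) \<le> B (esize x)"
    for b s x ys acc
    using that
  proof (induction ys arbitrary: s acc)
    case Nil
    then have "exec (?W b) s 1 s" by (intro exec.WhileFalse) simp
    then show ?case using Nil by (intro exI[of _ 1] exI[of _ s]) simp
  next
    case (Cons y ys)
    let ?n = "esize x"
    let ?p = "(x, acc, y)"
    define s1 where "s1 = s(b + 3 := enc ?p)"
    have accB: "esize acc \<le> B ?n" using Cons.prems(5)[of 0] by simp
    have p: "esize ?p \<le> 2 + ?n + B ?n + h ?n" using accB Cons.prems(4) by simp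
    have 1: "exec (Assign (b + 3) (NodeE (Var b) (NodeE (Var (b + 2)) (LeftE (Var (b + 1)))))) s (1 + esize ?p) s1"
      using exec.Assign[of "b + 3" "NodeE (Var b) (NodeE (Var (b + 2)) (LeftE (Var (b + 1))))" s] Cons.prems
      by (simp add: s1_def)
    obtain t2 s2 where 2: "exec (C (b + 3)) s1 t2 s2" "t2 \<le> T (esize ?p)" "s2 (b + 3) = enc (g x acc y)"
      "\<forall>i<b + 3. s2 i = s1 i"
      using C[of s1 "b + 3" ?p] unfolding s1_def by auto
    define s3 where "s3 = s2(b + 2 := enc (g x acc y))"
    have 3: "exec (Assign (b + 2) (Var (b + 3))) s2 (1 + esize (g x acc y)) s3"
      using exec.Assign[of "b + 2" "Var (b + 3)" s2] 2(3) by (simp add: s3_def)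
    define s4 where "s4 = s3(b + 1 := enc ys)"
    have "s3 (b + 1) = enc (y # ys)" using 2(4) Cons.prems(2) by (simp add: s3_def s1_def)
    then have 4: "exec (Assign (b + 1) (RightE (Var (b + 1)))) s3 (1 + esize ys) s4"
      using exec.Assign[of "b + 1" "RightE (Var (b + 1))" s3] by (simp add: s4_def)
    let ?t = "1 + esize ?p + (t2 + (1 + esize (g x acc y) + (1 + esize ys)))"
    have body: "exec (?body b) s ?t s4"
      by (intro exec.Seq[OF 1] exec.Seq[OF 2(1)] exec.Seq[OF 3] 4)
    have pres: "\<forall>i\<le>b. s4 i = s i" using 2(4) by (simp add: s4_def s3_def s1_def)
    have "\<exists>t s'. exec (?W b) s4 t s' \<and> t \<le> 1 + length ys * ?Q ?n
      \<and> s' (b + 2) = enc (foldl (g x) (g x acc y) ys) \<and> (\<forall>i\<le>b. s' i = s4 i)"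
    proof (rule Cons.IH)
      show "s4 b = enc x" using pres Cons.prems(1) by simp
      show "s4 (b + 1) = enc ys" "s4 (b + 2) = enc (g x acc y)" by (simp_all add: s4_def s3_def)
      show "esize ys \<le> h ?n" using Cons.prems(4) by simp
      show "esize (foldl (g x) (g x acc y) (take i ys)) \<le> B ?n" if "i \<le> length ys" for i
        using Cons.prems(5)[of "Suc i"] that by simp
    qed
    then obtain t5 s5 where 5: "exec (?W b) s4 t5 s5" "t5 \<le> 1 + length ys * ?Q ?n"
      "s5 (b + 2) = enc (foldl (g x) (g x acc y) ys)" "\<forall>i\<le>b. s5 i = s4 i" by blast
    have nz: "eval_expr (Var (b + 1)) s \<noteq> Leaf" using Cons.prems(2) by simp
    have "T (esize ?p) \<le> T (2 + ?n + B ?n + h ?n)" using T(1) p by (rule monoD)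
    moreover have "esize (g x acc y) \<le> B ?n" using Cons.prems(5)[of 1] by simp
    moreover have "esize ys \<le> h ?n" using Cons.prems(4) by simp
    ultimately have "1 + ?t \<le> ?Q ?n" using 2(2) p by linarith
    then have "1 + ?t + t5 \<le> 1 + length (y # ys) * ?Q ?n" using 5(2) by simp
    moreover have "exec (?W b) s (1 + ?t + t5) s5"
      by (rule exec.WhileTrue[OF nz body 5(1)])
    ultimately show ?case using 5(3,4) pres
      by (intro exI[of _ "1 + ?t + t5"] exI[of _ s5]) simp
  qed
  let ?P = "\<lambda>b. Seq (Assign (b + 1) (Var b)) (Seq (E (b + 1)) (Seq (Assign (b + 2) (Var b)) (Seq (D (b + 2))
    (Seq (?W b) (Assign b (Var (b + 2)))))))"
  let ?B = "\<lambda>n. 4 + 2 * n + R n + U n + h n * ?Q n + B n"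
  show ?thesis
  proof (rule ptimeI[where C = ?P and T = ?B])
    fix b :: nat and s and x :: 'a
    assume b: "s b = enc x"
    let ?n = "esize x"
    define s1 where "s1 = s(b + 1 := enc x)"
    have 1: "exec (Assign (b + 1) (Var b)) s (1 + esize x) s1"
      using exec.Assign[of "b + 1" "Var b" s] b by (simp add: s1_def)
    obtain t2 s2 where 2: "exec (E (b + 1)) s1 t2 s2" "t2 \<le> R ?n" "s2 (b + 1) = enc (xs x)"
      "\<forall>i<b + 1. s2 i = s1 i"
      using E[of s1 "b + 1" x] unfolding s1_def by auto
    have s2: "s2 b = enc x" using 2 b by (simp add: s1_def)
    define s3 where "s3 = s2(b + 2 := enc x)"
    have 3: "exec (Assign (b + 2) (Var b)) s2 (1 + esize x) s3"
      using exec.Assign[of "b + 2" "Var b" s2] s2 by (simp add: s3_def)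
    obtain t4 s4 where 4: "exec (D (b + 2)) s3 t4 s4" "t4 \<le> U ?n" "s4 (b + 2) = enc (init x)"
      "\<forall>i<b + 2. s4 i = s3 i"
      using D[of s3 "b + 2" x] unfolding s3_def by auto
    have "s4 b = enc x" "s4 (b + 1) = enc (xs x)" using 4 2 s2 by (simp_all add: s3_def)
    then have "\<exists>t s'. exec (?W b) s4 t s' \<and> t \<le> 1 + length (xs x) * ?Q ?n
      \<and> s' (b + 2) = enc (foldl (g x) (init x) (xs x)) \<and> (\<forall>i\<le>b. s' i = s4 i)"
      using loop 4(3) h(3) bound by blast
    then obtain t5 s5 where 5: "exec (?W b) s4 t5 s5" "t5 \<le> 1 + length (xs x) * ?Q ?n"
      "s5 (b + 2) = enc (foldl (g x) (init x) (xs x))" "\<forall>i\<le>b. s5 i = s4 i" by blast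
    let ?r = "foldl (g x) (init x) (xs x)"
    have 6: "exec (Assign b (Var (b + 2))) s5 (1 + esize ?r) (s5(b := enc ?r))"
      using exec.Assign[of b "Var (b + 2)" s5] 5(3) by simp
    let ?t = "1 + esize x + (t2 + (1 + esize x + (t4 + (t5 + (1 + esize ?r)))))"
    have ex: "exec (?P b) s ?t (s5(b := enc ?r))"
      by (intro exec.Seq[OF 1] exec.Seq[OF 2(1)] exec.Seq[OF 3] exec.Seq[OF 4(1)] exec.Seq[OF 5(1)] 6)
    have "length ys \<le> esize ys" for ys :: "'b list" by (induction ys) auto
    then have "length (xs x) \<le> h ?n" using h(3)[of x] le_trans by blast
    then have "length (xs x) * ?Q ?n \<le> h ?n * ?Q ?n" by (rule mult_le_mono1)
    moreover have "esize ?r \<le> B ?n" using bound[of "length (xs x)" x] by simp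
    ultimately have "?t \<le> ?B ?n" using 2(2) 4(2) 5(2) by linarith
    moreover have "\<forall>i<b. (s5(b := enc ?r)) i = s i" using 5 4 2 by (simp add: s3_def s1_def)
    ultimately show "\<exists>t s'. exec (?P b) s t s' \<and> t \<le> ?B ?n \<and> s' b = enc ?r \<and> (\<forall>i<b. s' i = s i)"
      using ex by (intro exI[of _ ?t] exI[of _ "s5(b := enc ?r)"]) simp
  qed (intro poly_bounded_intros R U T B poly_bounded_compose[OF T(2)] h)
qed

lemma esize_member: "y \<in> set ys \<Longrightarrow> esize y \<le> esize ys"
  by (induction ys) auto

lemma length_le_esize: "length ys \<le> esize ys"
  by (induction ys) auto

lemma size_enc_list_append [simp]:
  "size (enc_list e (xs @ ys)) = size (enc_list e xs) + size (enc_list e ys)"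
  by (induction xs) auto

text \<open>If a step adds an amount that does not depend on the accumulator, partial results stay
  below the initial size plus the number of rounds times that amount. Every loop below except the
  one for \<open>upt\<close> is of this kind.\<close>

lemma ptime_foldl:
  fixes g :: "'a :: enc \<Rightarrow> 'c :: enc \<Rightarrow> 'b :: enc \<Rightarrow> 'c"
  assumes "ptime xs" "ptime init" "ptime (\<lambda>p. g (fst p) (fst (snd p)) (snd (snd p)))"
    and q: "mono q" "poly_bounded q"
    and growth: "\<And>x acc y. esize (g x acc y) \<le> esize acc + q (esize x + esize y)"
  shows "ptime (\<lambda>x. foldl (g x) (init x) (xs x))"
proof -
  obtain h where h: "mono h" "poly_bounded h" "\<And>x. esize (xs x) \<le> h (esize x)"
    by (rule ptime_size[OF assms(1)]) (rule that)
  obtain l where l: "mono l" "poly_bounded l" "\<And>x. esize (init x) \<le> l (esize x)"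
    by (rule ptime_size[OF assms(2)]) (rule that)
  have fold: "esize (foldl (g x) acc ys) \<le> esize acc + length ys * q (esize x + esize zs)"
    if "set ys \<subseteq> set zs" for x acc ys and zs :: "'b list"
    using that
  proof (induction ys arbitrary: acc)
    case (Cons y ys)
    have "q (esize x + esize y) \<le> q (esize x + esize zs)"
      using esize_member[of y zs] Cons.prems by (intro monoD[OF q(1)]) simp
    then have "esize (g x acc y) \<le> esize acc + q (esize x + esize zs)"
      using growth[of x acc y] by linarith
    with Cons.IH[of "g x acc y"] Cons.prems show ?case by simp
  qed simp
  show ?thesis
  proof (rule ptime_foldl_bounded[where B = "\<lambda>n. l n + h n * q (n + h n)"])
    show "esize (foldl (g x) (init x) (take i (xs x))) \<le> l (esize x) + h (esize x) * q (esize x + h (esize x))"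
      if "i \<le> length (xs x)" for x i
    proof -
      have "esize (foldl (g x) (init x) (take i (xs x))) \<le> esize (init x) + i * q (esize x + esize (xs x))"
        using fold[OF set_take_subset, of x "init x" i "xs x"] that by (simp add: min_absorb2)
      also have "\<dots> \<le> l (esize x) + h (esize x) * q (esize x + h (esize x))"
        using that length_le_esize[of "xs x"] h(3)[of x]
        by (intro add_mono l(3) mult_mono monoD[OF q(1)]) auto
      finally show ?thesis .
    qed
  qed (use assms in \<open>auto intro!: poly_bounded_intros poly_bounded_compose[OF q(2)] h l\<close>)
qed

section \<open>List operations and unary arithmetic as folds\<close>

lemma ptime_rev [ptime_intros]:
  fixes f :: "'b :: enc \<Rightarrow> 'a :: enc list"
  assumes "ptime f"
  shows "ptime (\<lambda>x. rev (f x))"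
proof -
  have "foldl (\<lambda>acc y. y # acc) zs ys = rev ys @ zs" for ys zs :: "'a list"
    by (induction ys arbitrary: zs) auto
  moreover have "ptime (\<lambda>ys :: 'a :: enc list. foldl (\<lambda>acc y. y # acc) [] ys)"
    by (rule ptime_foldl[where q = Suc])
      (auto intro!: ptime_intros poly_bounded_intros monoI)
  ultimately have "ptime (\<lambda>ys :: 'a :: enc list. rev ys)" by simp
  from ptime_comp[OF this assms] show ?thesis .
qed

lemma ptime_append [ptime_intros]:
  fixes f :: "'a :: enc \<Rightarrow> 'b :: enc list"
  assumes "ptime f" "ptime g"
  shows "ptime (\<lambda>x. f x @ g x)"
proof -
  have "foldl (\<lambda>acc y. y # acc) zs (rev ys) = ys @ zs" for ys zs :: "'b list"
    by (induction ys arbitrary: zs) auto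
  moreover have "ptime (\<lambda>x. foldl (\<lambda>acc y. y # acc) (g x) (rev (f x)))"
    by (rule ptime_foldl[where q = Suc])
      (auto intro!: ptime_intros poly_bounded_intros monoI assms)
  ultimately show ?thesis by simp
qed

lemma ptime_map [ptime_intros]:
  fixes xs :: "'a :: enc \<Rightarrow> 'b :: enc list" and f :: "'a \<Rightarrow> 'b \<Rightarrow> 'c :: enc"
  assumes "ptime (\<lambda>p. f (fst p) (snd p))" "ptime xs"
  shows "ptime (\<lambda>x. map (f x) (xs x))"
proof -
  obtain h where h: "mono h" "poly_bounded h" "\<And>p. esize (f (fst p) (snd p)) \<le> h (esize p)"
    by (rule ptime_size[OF assms(1)]) (rule that)
  have f: "ptime (\<lambda>p :: 'a \<times> 'c list \<times> 'b. f (fst p) (snd (snd p)))"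
    using ptime_comp[OF assms(1), of "\<lambda>p. (fst p, snd (snd p))"] by (simp add: ptime_intros)
  have "foldl (\<lambda>acc y. f x y # acc) zs ys = rev (map (f x) ys) @ zs" for x ys zs
    by (induction ys arbitrary: zs) auto
  \<comment> \<open>The argument \<open>(x, y)\<close> is one node larger than its parts together,
    hence the inner \<open>Suc\<close>; the outer one is the new list node.\<close>
  moreover have "ptime (\<lambda>x. rev (foldl (\<lambda>acc y. f x y # acc) [] (xs x)))"
    using h(3)[of "(x, y)" for x y] h(1)
    by (intro ptime_rev ptime_foldl[where q = "\<lambda>n. Suc (h (Suc n))"])
      (auto intro!: ptime_intros poly_bounded_intros poly_bounded_compose[OF h(2)] assms f simp: mono_def)
  ultimately show ?thesis by simp
qed

lemma ptime_filter [ptime_intros]: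
  fixes xs :: "'a :: enc \<Rightarrow> 'b :: enc list"
  assumes "ptime (\<lambda>p. P (fst p) (snd p))" "ptime xs"
  shows "ptime (\<lambda>x. filter (P x) (xs x))"
proof -
  have P: "ptime (\<lambda>p :: 'a \<times> 'b list \<times> 'b. P (fst p) (snd (snd p)))"
    using ptime_comp[OF assms(1), of "\<lambda>p. (fst p, snd (snd p))"] by (simp add: ptime_intros)
  have "foldl (\<lambda>acc y. if P x y then y # acc else acc) zs ys = rev (filter (P x) ys) @ zs" for x ys zs
    by (induction ys arbitrary: zs) auto
  moreover have "ptime (\<lambda>x. rev (foldl (\<lambda>acc y. if P x y then y # acc else acc) [] (xs x)))"
    by (intro ptime_rev ptime_foldl[where q = Suc])
      (auto intro!: ptime_intros poly_bounded_intros monoI assms P)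
  ultimately show ?thesis by simp
qed

lemma ptime_concat [ptime_intros]:
  fixes f :: "'b :: enc \<Rightarrow> 'a :: enc list list"
  assumes "ptime f"
  shows "ptime (\<lambda>x. concat (f x))"
proof -
  have "foldl (@) zs ys = zs @ concat ys" for ys and zs :: "'a list"
    by (induction ys arbitrary: zs) auto
  moreover have "ptime (\<lambda>ys :: 'a :: enc list list. foldl (@) [] ys)"
    by (rule ptime_foldl[where q = "\<lambda>n. n"])
      (auto intro!: ptime_intros poly_bounded_intros monoI)
  ultimately have "ptime (\<lambda>ys :: 'a :: enc list list. concat ys)" by simp
  from ptime_comp[OF this assms] show ?thesis .
qed

lemma ptime_conj [ptime_intros]:
  assumes "ptime p" "ptime q" shows "ptime (\<lambda>x. p x \<and> q x)"
proof -
  have "ptime (\<lambda>x. if p x then q x else False)" by (intro ptime_intros assms)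
  moreover have "(if p x then q x else False) = (p x \<and> q x)" for x by simp
  ultimately show ?thesis by (simp only:)
qed

lemma ptime_not [ptime_intros]:
  assumes "ptime p" shows "ptime (\<lambda>x. \<not> p x)"
proof -
  have "ptime (\<lambda>x. if p x then False else True)" by (intro ptime_intros assms)
  moreover have "(if p x then False else True) = (\<not> p x)" for x by simp
  ultimately show ?thesis by (simp only:)
qed

lemma ptime_disj [ptime_intros]:
  assumes "ptime p" "ptime q" shows "ptime (\<lambda>x. p x \<or> q x)"
proof -
  have "ptime (\<lambda>x. \<not> (\<not> p x \<and> \<not> q x))" by (intro ptime_intros assms)
  then show ?thesis by simp
qed

lemma ptime_eq_bool [ptime_intros]:
  fixes p q :: "'a :: enc \<Rightarrow> bool"
  assumes "ptime p" "ptime q" shows "ptime (\<lambda>x. p x = q x)"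
proof -
  have "ptime (\<lambda>x. if p x then q x else \<not> q x)" by (intro ptime_intros assms)
  moreover have "(if p x then q x else \<not> q x) = (p x = q x)" for x by auto
  ultimately show ?thesis by simp
qed

lemma ptime_list_ex [ptime_intros]:
  assumes "ptime (\<lambda>p. P (fst p) (snd p))" "ptime xs"
  shows "ptime (\<lambda>x. list_ex (P x) (xs x))"
proof -
  have "ptime (\<lambda>x. case filter (P x) (xs x) of [] \<Rightarrow> False | y # ys \<Rightarrow> True)"
    by (intro ptime_intros ptime_case_list assms)
  moreover have "(case filter (P x) (xs x) of [] \<Rightarrow> False | y # ys \<Rightarrow> True) = list_ex (P x) (xs x)" for x
    using filter_empty_conv[of "P x" "xs x"] by (auto simp: list_ex_iff split: list.split)
  ultimately show ?thesis by simp
qed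

lemma ptime_list_all [ptime_intros]:
  assumes "ptime (\<lambda>p. P (fst p) (snd p))" "ptime xs"
  shows "ptime (\<lambda>x. list_all (P x) (xs x))"
proof -
  have "ptime (\<lambda>x. \<not> list_ex (\<lambda>y. \<not> P x y) (xs x))" by (intro ptime_intros assms)
  then show ?thesis by (simp add: list_ex_iff list_all_iff)
qed

text \<open>As \<open>False\<close> is encoded by a leaf, a unary number can be read as a list, and
  a fold over \<open>replicate n False\<close> is a loop of \<open>n\<close> rounds.\<close>

lemma enc_nat_replicate: "enc n = enc (replicate n False)"
  by (induction n) auto

lemma ptime_replicate_False [ptime_intros]:
  "ptime f \<Longrightarrow> ptime (\<lambda>x. replicate (f x) False)"
  by (rule ptime_comp[of "\<lambda>n. replicate n False"], rule ptime_same_enc) (simp only: enc_nat_replicate)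

lemma esize_nat [simp]: "esize (n :: nat) = n"
  by (induction n) auto

lemma ptime_diff_nat [ptime_intros]:
  fixes f g :: "'a :: enc \<Rightarrow> nat"
  assumes "ptime f" "ptime g"
  shows "ptime (\<lambda>x. f x - g x)"
proof -
  have "foldl (\<lambda>acc y. acc - 1) m (replicate n False) = m - n" for m n :: nat
    by (induction n arbitrary: m) auto
  moreover have "ptime (\<lambda>x. foldl (\<lambda>acc y. acc - 1) (f x) (replicate (g x) False))"
    by (rule ptime_foldl[where q = Suc])
      (auto intro!: ptime_intros poly_bounded_intros monoI assms)
  ultimately show ?thesis by simp
qed

lemma ptime_case_nat:
  assumes "ptime l" "ptime f" "ptime g"
  shows "ptime (\<lambda>x. if l x = (0 :: nat) then f x else g x)"
proof -
  have "ptime (\<lambda>x. case replicate (l x) False of [] \<Rightarrow> f x | y # ys \<Rightarrow> g x)"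
    by (intro ptime_intros ptime_case_list assms ptime_comp[OF assms(3)])
  moreover have "(case replicate (l x) False of [] \<Rightarrow> f x | y # ys \<Rightarrow> g x) = (if l x = 0 then f x else g x)" for x
    by (cases "l x") auto
  ultimately show ?thesis by simp
qed

lemma ptime_le_nat [ptime_intros]:
  fixes f g :: "'a :: enc \<Rightarrow> nat"
  assumes "ptime f" "ptime g"
  shows "ptime (\<lambda>x. f x \<le> g x)"
proof -
  have "ptime (\<lambda>x. if f x - g x = 0 then True else False)"
    by (intro ptime_case_nat ptime_intros assms)
  moreover have "(if f x - g x = 0 then True else False) = (f x \<le> g x)" for x by auto
  ultimately show ?thesis by simp
qed

lemma ptime_less_nat [ptime_intros]:
  fixes f g :: "'a :: enc \<Rightarrow> nat"
  assumes "ptime f" "ptime g"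
  shows "ptime (\<lambda>x. f x < g x)"
proof -
  have "ptime (\<lambda>x. Suc (f x) \<le> g x)" by (intro ptime_intros assms)
  then show ?thesis by (simp only: Suc_le_eq)
qed

lemma ptime_eq_nat [ptime_intros]:
  fixes f g :: "'a :: enc \<Rightarrow> nat"
  assumes "ptime f" "ptime g"
  shows "ptime (\<lambda>x. f x = g x)"
proof -
  have "ptime (\<lambda>x. f x \<le> g x \<and> g x \<le> f x)" by (intro ptime_intros assms)
  then show ?thesis by (simp only: eq_iff)
qed

lemma ptime_drop [ptime_intros]:
  fixes n :: "'a :: enc \<Rightarrow> nat" and xs :: "'a \<Rightarrow> 'b :: enc list"
  assumes "ptime n" "ptime xs"
  shows "ptime (\<lambda>x. drop (n x) (xs x))"
proof -
  have "foldl (\<lambda>acc y. tl acc) ys (replicate m False) = drop m ys" for m and ys :: "'b list"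
    by (induction m arbitrary: ys) (auto simp: drop_Suc)
  moreover have tl: "size (enc_list e (tl ys)) \<le> Suc (size (enc_list e ys) + m)" for e m and ys :: "'b list"
    by (cases ys) auto
  have "ptime (\<lambda>x. foldl (\<lambda>acc y. tl acc) (xs x) (replicate (n x) False))"
    by (intro ptime_foldl[where q = Suc])
      (auto intro!: ptime_intros poly_bounded_intros monoI assms tl)
  ultimately show ?thesis by simp
qed

lemma ptime_length [ptime_intros]:
  fixes f :: "'b :: enc \<Rightarrow> 'a :: enc list"
  assumes "ptime f"
  shows "ptime (\<lambda>x. length (f x))"
proof -
  have "foldl (\<lambda>acc y. Suc acc) m ys = m + length ys" for m and ys :: "'a list"
    by (induction ys arbitrary: m) auto
  moreover have "ptime (\<lambda>ys :: 'a :: enc list. foldl (\<lambda>acc y. Suc acc) 0 ys)"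
    by (rule ptime_foldl[where q = Suc])
      (auto intro!: ptime_intros poly_bounded_intros monoI)
  ultimately have "ptime (\<lambda>ys :: 'a :: enc list. length ys)" by simp
  from ptime_comp[OF this assms] show ?thesis .
qed

text \<open>Each round pushes the current length of the accumulator, so the growth is not
  independent of it, and partial results are bounded directly.\<close>

lemma ptime_upt [ptime_intros]:
  fixes n :: "'a :: enc \<Rightarrow> nat"
  assumes "ptime n"
  shows "ptime (\<lambda>x. [0..<n x])"
proof -
  let ?g = "\<lambda>acc (y :: bool). length acc # acc"
  have fold: "foldl (?g) [] (replicate m False) = rev [0..<m]" for m
  proof (induction m)
    case (Suc m)
    have "replicate (Suc m) False = replicate m False @ [False]" by (simp add: replicate_append_same)
    with Suc show ?case by (simp del: replicate.simps)
  qed simp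
  have size: "esize (rev [0..<m]) \<le> m * (m + 1)" for m by (induction m) auto
  have "ptime (\<lambda>x :: nat. foldl (?g) [] (replicate x False))"
  proof (rule ptime_foldl_bounded[where B = "\<lambda>n. n * (n + 1)"])
    fix x i :: nat assume "i \<le> length (replicate x False)"
    then have i: "i \<le> x" by simp
    then have "esize (foldl (?g) [] (take i (replicate x False))) \<le> i * (i + 1)"
      using size[of i] fold[of i] by (simp add: take_replicate min_absorb1)
    also have "\<dots> \<le> x * (x + 1)" using i by (intro mult_mono) auto
    finally show "esize (foldl (?g) [] (take i (replicate x False))) \<le> esize x * (esize x + 1)" by simp
  qed (intro ptime_intros poly_bounded_intros)+
  then have "ptime (\<lambda>x :: nat. rev (foldl (?g) [] (replicate x False)))" by (rule ptime_rev)
  then have "ptime (\<lambda>x :: nat. [0..<x])" using fold by simp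
  from ptime_comp[OF this assms] show ?thesis .
qed

lemma ptime_product [ptime_intros]:
  assumes "ptime xs" "ptime ys"
  shows "ptime (\<lambda>x. List.product (xs x) (ys x))"
proof -
  have "ptime (\<lambda>x. concat (map (\<lambda>a. map (\<lambda>b. (a, b)) (ys x)) (xs x)))"
    by (intro ptime_intros assms ptime_comp[OF assms(2)])
  then show ?thesis by (simp add: product_concat_map)
qed


section \<open>An auction for bipartite matchings\<close>

text \<open>A vertex, its price and its holder; the holder list has at most one element and plays
  the part of an option.\<close>

type_synonym ('v, 'd) entry = "'v \<times> nat \<times> 'd list"

abbreviation price :: "('v, 'd) entry \<Rightarrow> nat" where "price e \<equiv> fst (snd e)"
abbreviation holder :: "('v, 'd) entry \<Rightarrow> 'd list" where "holder e \<equiv> snd (snd e)"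

text \<open>\<open>fst acc\<close> holds at most one entry, the cheapest adjacent one so far; a
  strictly cheaper one sends it back to the other entries. For an empty \<open>fst acc\<close> the
  price test is vacuous.\<close>

definition pick_step where
  "pick_step adj acc e =
     (if adj (fst e) \<and> list_all (\<lambda>b. price e < price b) (fst acc) then ([e], fst acc @ snd acc)
      else (fst acc, e # snd acc))"

definition pick :: "('v \<Rightarrow> bool) \<Rightarrow> ('v, 'd) entry list \<Rightarrow> ('v, 'd) entry list \<times> ('v, 'd) entry list" where
  "pick adj es = foldl (pick_step adj) ([], []) es"

text \<open>A displaced holder waits again. A demand without an adjacent vertex cheaper than
  \<open>N\<close> is dropped for good; without this cutoff, competing demands could raise prices
  forever.\<close>

definition bid :: "('d \<Rightarrow> 'v \<Rightarrow> bool) \<Rightarrow> nat \<Rightarrow> 'd \<Rightarrow> 'd list \<Rightarrow> ('v, 'd) entry list \<Rightarrow> 'd list \<times> ('v, 'd) entry list" where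
  "bid adj N p ps es =
     (case fst (pick (adj p) es) of
       [] \<Rightarrow> (ps, es)
     | b # bs \<Rightarrow> if price b < N then (holder b @ ps, (fst b, Suc (price b), [p]) # snd (pick (adj p) es))
                else (ps, es))"

definition auction_step where
  "auction_step adj N st = (case fst st of [] \<Rightarrow> st | p # ps \<Rightarrow> bid adj N p ps (snd st))"

text \<open>
  Every step settles a demand or raises a price, and prices never exceed the number of demands plus
  one; this gives the number of steps after which no demand is waiting.
\<close>

definition auction :: "('d \<Rightarrow> 'v \<Rightarrow> bool) \<Rightarrow> 'd list \<Rightarrow> 'v list \<Rightarrow> 'd list \<times> ('v, 'd) entry list" where
  "auction adj ds vs = foldl (\<lambda>st d. auction_step adj (Suc (length ds)) st) (ds, map (\<lambda>v. (v, 0, [])) vs)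
     (replicate (length ds) False @ concat (map (\<lambda>v. replicate (Suc (length ds)) False) vs))"

definition sold :: "('v, 'd) entry list \<Rightarrow> 'v list" where
  "sold es = map fst (filter (\<lambda>e. 0 < length (holder e)) es)"

section \<open>Invariant and termination of the auction\<close>

lemma pick_props:
  "mset (fst (pick adj es) @ snd (pick adj es)) = mset es
   \<and> length (fst (pick adj es)) \<le> 1
   \<and> (\<forall>b\<in>set (fst (pick adj es)). adj (fst b) \<and> (\<forall>e\<in>set es. adj (fst e) \<longrightarrow> price b \<le> price e))
   \<and> (fst (pick adj es) = [] \<longrightarrow> (\<forall>e\<in>set es. \<not> adj (fst e)))"
proof (induction es rule: rev_induct)
  case Nil
  then show ?case by (simp add: pick_def)
next
  case (snoc e es)
  obtain best rest where p: "pick adj es = (best, rest)" by (cases "pick adj es")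
  have eq: "pick adj (es @ [e]) = pick_step adj (best, rest) e" using p by (simp add: pick_def)
  show ?case
  proof (cases best)
    case Nil
    then show ?thesis using snoc p unfolding eq by (auto simp: pick_step_def)
  next
    case (Cons b bs)
    then have "best = [b]" using snoc p by simp
    then show ?thesis using snoc p unfolding eq by (auto simp: pick_step_def split: if_splits)
  qed
qed

text \<open>The comparison of \<open>price e\<close> with \<open>Suc (price e')\<close> is the
  approximate complementary slackness of auction algorithms, with increment one. The last clause
  concerns dropped demands, which neither wait nor hold. A positive price forces a holder because a
  vertex once taken is only ever taken over.\<close>

definition auction_inv where
  "auction_inv adj N D V st \<longleftrightarrow> (case st of (ps, es) \<Rightarrow>
     distinct (map fst es) \<and> fst ` set es = V \<and> distinct ps \<and> set ps \<subseteq> D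
   \<and> (\<forall>e\<in>set es. length (holder e) \<le> 1 \<and> set (holder e) \<subseteq> D \<and> set (holder e) \<inter> set ps = {}
        \<and> (0 < price e \<longrightarrow> holder e \<noteq> []) \<and> (\<forall>p\<in>set (holder e). adj p (fst e)))
   \<and> (\<forall>e\<in>set es. \<forall>e'\<in>set es. set (holder e) \<inter> set (holder e') \<noteq> {} \<longrightarrow> e = e')
   \<and> (\<forall>e\<in>set es. \<forall>p\<in>set (holder e). \<forall>e'\<in>set es. adj p (fst e') \<longrightarrow> price e \<le> Suc (price e'))
   \<and> (\<forall>p\<in>D. p \<notin> set ps \<longrightarrow> (\<forall>e\<in>set es. p \<notin> set (holder e)) \<longrightarrow>
        (\<forall>e\<in>set es. adj p (fst e) \<longrightarrow> N \<le> price e)))"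

definition auction_measure where
  "auction_measure N st = length (fst st) + (\<Sum>e\<in>#mset (snd st). N - price e)"

text \<open>Slackness survives a bid: the bidder pays one more than the least price it sees, and for
  all other holders prices can only rise on the larger side. The measure drops since a successful
  bid trades the bidder for at most one displaced holder and raises a price below \<open>N\<close>,
  while a failed bid shortens the waiting list.\<close>

lemma auction_step_inv:
  assumes inv: "auction_inv adj N D V st" and "fst st \<noteq> []"
  shows "auction_inv adj N D V (auction_step adj N st)
    \<and> auction_measure N (auction_step adj N st) < auction_measure N st"
proof -
  obtain es p ps where st: "st = (p # ps, es)" using assms(2) by (cases st) (auto simp: neq_Nil_conv)
  define U where Cons: "U = p # ps"
  obtain best rest where pick: "pick (adj p) es = (best, rest)" by (cases "pick (adj p) es")
  note pp = pick_props[of "adj p" es, unfolded pick, simplified]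
  have eq: "auction_step adj N st = bid adj N p ps es"
    using st Cons by (simp add: auction_step_def)
  show ?thesis
  proof (cases "\<exists>b bs. best = b # bs \<and> price b < N")
    case False
    then have "bid adj N p ps es = (ps, es)"
      using pick by (auto simp: bid_def split: list.split)
    moreover have "\<forall>e\<in>set es. adj p (fst e) \<longrightarrow> N \<le> price e"
    proof (cases best)
      case (Cons b bs)
      then have "N \<le> price b" using False by auto
      then show ?thesis using pp Cons by fastforce
    qed (use pp in auto)
    moreover from this have "auction_inv adj N D V (ps, es)"
      using inv unfolding st auction_inv_def by auto
    ultimately show ?thesis unfolding eq by (simp add: auction_measure_def st)
  next
    case True
    then obtain b where b: "best = [b]" "price b < N" using pp by auto
    obtain v c h where bv: "b = (v, c, h)" by (cases b)
    have m: "mset es = mset ((v, c, h) # rest)" using pp b bv by simp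
    have es: "set es = insert (v, c, h) (set rest)" using mset_eq_setD[OF m] by simp
    have min: "adj p v" "\<forall>e\<in>set es. adj p (fst e) \<longrightarrow> c \<le> price e" "c < N"
      using pp b bv by auto
    have eq': "bid adj N p ps es = (h @ ps, (v, Suc c, [p]) # rest)"
      using pick b bv by (auto simp: bid_def)
    have "mset (map fst es) = mset (map fst ((v, c, h) # rest))" using m by (metis mset_map)
    then have dist: "distinct (map fst ((v, c, h) # rest)) = distinct (map fst es)"
      by (metis mset_eq_imp_distinct_iff)
    have i: "distinct (map fst es)" "fst ` set es = V" "distinct U" "set U \<subseteq> D"
      using inv unfolding st Cons[symmetric] auction_inv_def prod.case by simp_all
    have i5: "length (holder e) \<le> 1 \<and> set (holder e) \<subseteq> D \<and> set (holder e) \<inter> set U = {}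
        \<and> (0 < price e \<longrightarrow> holder e \<noteq> []) \<and> (\<forall>p\<in>set (holder e). adj p (fst e))"
      if "e \<in> set es" for e
      using inv unfolding st Cons[symmetric] auction_inv_def prod.case by (elim conjE) (rule bspec[OF _ that])
    have "\<forall>e\<in>set es. \<forall>e'\<in>set es. set (holder e) \<inter> set (holder e') \<noteq> {} \<longrightarrow> e = e'"
      using inv unfolding st Cons[symmetric] auction_inv_def prod.case by (elim conjE)
    then have i6: "e = e'" if "e \<in> set es" "e' \<in> set es" "q \<in> set (holder e)" "q \<in> set (holder e')" for e e' q
      using that by blast
    have "\<forall>e\<in>set es. \<forall>p\<in>set (holder e). \<forall>e'\<in>set es. adj p (fst e') \<longrightarrow> price e \<le> Suc (price e')"
      using inv unfolding st Cons[symmetric] auction_inv_def prod.case by (elim conjE)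
    then have i7: "price e \<le> Suc (price e')"
      if "e \<in> set es" "q \<in> set (holder e)" "e' \<in> set es" "adj q (fst e')" for e q e'
      using that by blast
    have "\<forall>p\<in>D. p \<notin> set U \<longrightarrow> (\<forall>e\<in>set es. p \<notin> set (holder e)) \<longrightarrow>
        (\<forall>e\<in>set es. adj p (fst e) \<longrightarrow> N \<le> price e)"
      using inv unfolding st Cons[symmetric] auction_inv_def prod.case by (elim conjE)
    then have i8: "N \<le> price e"
      if "q \<in> D" "q \<notin> set U" "\<forall>e\<in>set es. q \<notin> set (holder e)" "e \<in> set es" "adj q (fst e)" for q e
      using that by blast
    let ?new = "(v, Suc c, [p])" and ?old = "(v, c, h)"
    have old: "?old \<in> set es" and rest: "\<And>e. e \<in> set rest \<Longrightarrow> e \<in> set es" unfolding es by simp_all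
    have h: "length h \<le> 1" "set h \<subseteq> D" "set h \<inter> set U = {}" using i5[OF old] by simp_all
    have p: "p \<in> D" "p \<in> set U" using i(4) unfolding Cons by simp_all
    have rest_old: "set (holder e) \<inter> set h = {}" if "e \<in> set rest" for e
    proof -
      have "v \<notin> fst ` set rest" using dist i(1) by simp
      then have "fst e \<noteq> v" using that by blast
      then have "e \<noteq> ?old" by (metis fst_conv)
      then show ?thesis using i6[OF rest[OF that] old] by auto
    qed
    have rest_p: "p \<notin> set (holder e)" if "e \<in> set rest" for e
      using i5[OF rest[OF that]] p(2) by blast
    have new_le: "Suc c \<le> Suc (price e)" if "e \<in> set es" "adj p (fst e)" for e
      using min(2) that by simp
    have "auction_inv adj N D V (h @ ps, ?new # rest)"
      unfolding auction_inv_def prod.case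
    proof (intro conjI)
      show "distinct (map fst (?new # rest))" using dist i(1) by simp
      show "fst ` set (?new # rest) = V" using i(2) unfolding es by simp
      have "distinct h" using h(1) by (cases h) auto
      then show "distinct (h @ ps)" using i(3) h(3) unfolding Cons by auto
      show "set (h @ ps) \<subseteq> D" using i(4) h(2) unfolding Cons by simp
      show "\<forall>e\<in>set (?new # rest). length (holder e) \<le> 1 \<and> set (holder e) \<subseteq> D \<and> set (holder e) \<inter> set (h @ ps) = {}
        \<and> (0 < price e \<longrightarrow> holder e \<noteq> []) \<and> (\<forall>p\<in>set (holder e). adj p (fst e))" (is "\<forall>e\<in>_. ?I e")
      proof
        fix e assume "e \<in> set (?new # rest)"
        then consider "e = ?new" | "e \<in> set rest" by auto
        then show "?I e"
        proof cases
          case 1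
          have "p \<notin> set (h @ ps)" using h(3) i(3) unfolding Cons by auto
          with 1 p(1) min(1) show ?thesis by simp
        next
          case 2
          have "set (holder e) \<inter> set ps = {}" using i5[OF rest[OF 2]] unfolding Cons by auto
          then have "set (holder e) \<inter> set (h @ ps) = {}" using rest_old[OF 2] by auto
          then show ?thesis using i5[OF rest[OF 2]] by blast
        qed
      qed
      show "\<forall>e\<in>set (?new # rest). \<forall>e'\<in>set (?new # rest). set (holder e) \<inter> set (holder e') \<noteq> {} \<longrightarrow> e = e'"
      proof (intro ballI impI)
        fix e e' assume e: "e \<in> set (?new # rest)" "e' \<in> set (?new # rest)" "set (holder e) \<inter> set (holder e') \<noteq> {}"
        then obtain q where q: "q \<in> set (holder e)" "q \<in> set (holder e')" by blast
        have *: "f \<in> set rest \<longleftrightarrow> q \<noteq> p" if "f \<in> set (?new # rest)" "q \<in> set (holder f)" for f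
          using that rest_p[of f] by auto
        then show "e = e'" using *[OF e(1) q(1)] *[OF e(2) q(2)] e(1,2) i6[OF rest rest q]
          by (cases "q = p") simp_all
      qed
      show "\<forall>e\<in>set (?new # rest). \<forall>q\<in>set (holder e). \<forall>e'\<in>set (?new # rest).
        adj q (fst e') \<longrightarrow> price e \<le> Suc (price e')"
      proof (intro ballI impI)
        fix e q e' assume a: "e \<in> set (?new # rest)" "q \<in> set (holder e)" "e' \<in> set (?new # rest)" "adj q (fst e')"
        \<comment> \<open>The comparison is made with the prices before the bid; the only price that
          changes on the right-hand side goes up.\<close>
        have 1: "price e \<le> Suc (price f)" if "f \<in> set es" "adj q (fst f)" for f
          using a(1,2) new_le[OF that(1)] i7[OF rest _ that, of e] that(2) by auto
        show "price e \<le> Suc (price e')"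
        proof (cases "e' = ?new")
          case True
          then show ?thesis using 1[OF old] a(4) by simp
        next
          case False
          then show ?thesis using 1[OF rest, of e'] a(3,4) by simp
        qed
      qed
      show "\<forall>q\<in>D. q \<notin> set (h @ ps) \<longrightarrow> (\<forall>e\<in>set (?new # rest). q \<notin> set (holder e)) \<longrightarrow>
        (\<forall>e\<in>set (?new # rest). adj q (fst e) \<longrightarrow> N \<le> price e)"
      proof (intro ballI impI)
        fix q e assume q: "q \<in> D" "q \<notin> set (h @ ps)" "\<forall>e\<in>set (?new # rest). q \<notin> set (holder e)"
          and e: "e \<in> set (?new # rest)" "adj q (fst e)"
        have "q \<notin> set U" "\<forall>e\<in>set es. q \<notin> set (holder e)" using q(2,3) unfolding Cons es by auto
        then have *: "N \<le> price f" if "f \<in> set es" "adj q (fst f)" for f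
          using i8[OF q(1)] that by blast
        show "N \<le> price e"
        proof (cases "e = ?new")
          case True
          then show ?thesis using *[OF old] e(2) by simp
        next
          case False
          then show ?thesis using *[OF rest, of e] e by simp
        qed
      qed
    qed
    moreover have "auction_measure N (h @ ps, ?new # rest) < auction_measure N st"
      using min(3) h(1) by (simp add: auction_measure_def st m)
    ultimately show ?thesis unfolding eq eq' by blast
  qed
qed

text \<open>The elements of \<open>xs\<close> merely count rounds; once nothing waits, the remaining
  rounds change nothing.\<close>

lemma auction_steps:
  fixes xs :: "'c list"
  assumes "auction_inv adj N D V st" "auction_measure N st \<le> length xs"
  shows "auction_inv adj N D V (foldl (\<lambda>st d. auction_step adj N st) st xs)
    \<and> fst (foldl (\<lambda>st d. auction_step adj N st) st xs) = []"
  using assms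
proof (induction xs arbitrary: st)
  case Nil
  then show ?case by (auto simp: auction_measure_def)
next
  case (Cons x xs)
  show ?case
  proof (cases "fst st = []")
    case True
    then have step: "auction_step adj N st = st" by (simp add: auction_step_def)
    have "foldl (\<lambda>st d. auction_step adj N st) st ys = st" for ys :: "'c list"
      by (induction ys) (simp_all add: step)
    then show ?thesis using True Cons.prems(1) by (simp add: step)
  next
    case False
    from auction_step_inv[OF Cons.prems(1) False] show ?thesis
      using Cons.IH[of "auction_step adj N st"] Cons.prems(2) by simp
  qed
qed

lemma auction_final:
  fixes adj :: "'d \<Rightarrow> 'v \<Rightarrow> bool"
  assumes "distinct ds" "distinct vs"
  obtains es where "auction adj ds vs = ([], es)"
    "auction_inv adj (Suc (length ds)) (set ds) (set vs) ([], es)"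
proof -
  let ?N = "Suc (length ds)"
  let ?st = "(ds, map (\<lambda>v. (v, 0, [] :: 'd list)) vs)"
  have "auction_inv adj ?N (set ds) (set vs) ?st"
    using assms by (auto simp: auction_inv_def o_def image_image)
  \<comment> \<open>All prices start at 0, so the initial measure is exactly the number of rounds
    that \<open>auction\<close> provides.\<close>
  moreover have "(\<Sum>e\<in>#mset (map (\<lambda>v. (v, 0, [] :: 'd list)) vs). N - price e)
      = length (concat (map (\<lambda>v. replicate N False) vs))" for N
    by (induction vs) auto
  then have "auction_measure ?N ?st \<le> length (replicate (length ds) False @ concat (map (\<lambda>v. replicate ?N False) vs))"
    unfolding auction_measure_def fst_conv snd_conv length_append length_replicate by (simp only: order_refl)
  ultimately have *: "auction_inv adj ?N (set ds) (set vs) (auction adj ds vs) \<and> fst (auction adj ds vs) = []"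
    unfolding auction_def by (rule auction_steps)
  obtain us es where "auction adj ds vs = (us, es)"
    by (cases "auction adj ds vs")
  moreover from this * have "us = []" by simp
  ultimately show thesis using * that by simp
qed

text \<open>In the last claim one \<open>W\<close> serves every \<open>J\<close> and
  \<open>Q\<close>: this is what allows the kernel to be chosen before a packing is known. The bound
  on \<open>W\<close> holds because distinct sold vertices have distinct holders.\<close>

lemma auction_sold:
  fixes adj :: "'d \<Rightarrow> 'v \<Rightarrow> bool"
  assumes "distinct ds" "distinct vs"
  defines "W \<equiv> sold (snd (auction adj ds vs))"
  shows "distinct W" "set W \<subseteq> set vs" "length W \<le> length ds"
    and "\<And>Q J. J \<subseteq> set ds \<Longrightarrow> inj_on Q J \<Longrightarrow> (\<And>p. p \<in> J \<Longrightarrow> Q p \<in> set vs \<and> adj p (Q p)) \<Longrightarrow>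
      \<exists>Q'. inj_on Q' J \<and> (\<forall>p\<in>J. Q' p \<in> set W \<and> adj p (Q' p))"
proof -
  obtain es where es: "auction adj ds vs = ([], es)"
    and inv: "auction_inv adj (Suc (length ds)) (set ds) (set vs) ([], es)"
    by (rule auction_final[OF assms(1,2)]) (rule that)
  let ?N = "Suc (length ds)"
  have i: "distinct (map fst es)" "fst ` set es = set vs"
     "\<And>e. e \<in> set es \<Longrightarrow> length (holder e) \<le> 1 \<and> set (holder e) \<subseteq> set ds
        \<and> (0 < price e \<longrightarrow> holder e \<noteq> []) \<and> (\<forall>p\<in>set (holder e). adj p (fst e))"
     "\<And>e e'. e \<in> set es \<Longrightarrow> e' \<in> set es \<Longrightarrow> set (holder e) \<inter> set (holder e') \<noteq> {} \<Longrightarrow> e = e'"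
     "\<And>e q e'. e \<in> set es \<Longrightarrow> q \<in> set (holder e) \<Longrightarrow> e' \<in> set es \<Longrightarrow> adj q (fst e') \<Longrightarrow> price e \<le> Suc (price e')"
     "\<And>q e. q \<in> set ds \<Longrightarrow> (\<forall>e\<in>set es. q \<notin> set (holder e)) \<Longrightarrow> e \<in> set es \<Longrightarrow> adj q (fst e) \<Longrightarrow> ?N \<le> price e"
    using inv unfolding auction_inv_def by auto
  let ?S = "filter (\<lambda>e. 0 < length (holder e)) es"
  have W: "W = map fst ?S" by (simp add: W_def es sold_def)
  show "distinct W" unfolding W by (rule distinct_map_filter[OF i(1)])
  show "set W \<subseteq> set vs" unfolding W using i(2) by auto
  have "inj_on (hd \<circ> holder) (set ?S)"
  proof (rule inj_onI)
    fix e e' assume "e \<in> set ?S" "e' \<in> set ?S" "(hd \<circ> holder) e = (hd \<circ> holder) e'"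
    then have "hd (holder e) \<in> set (holder e) \<inter> set (holder e')"
      using hd_in_set[of "holder e"] hd_in_set[of "holder e'"] by auto
    then show "e = e'" using i(4)[of e e'] \<open>e \<in> set ?S\<close> \<open>e' \<in> set ?S\<close> by fastforce
  qed
  moreover have "(hd \<circ> holder) ` set ?S \<subseteq> set ds"
    using i(3) by (force dest: hd_in_set)
  ultimately have card: "card (set ?S) \<le> card (set ds)"
    by (metis card_inj_on_le List.finite_set)
  have "distinct ?S" using i(1) by (simp add: distinct_map)
  then show "length W \<le> length ds"
    using card distinct_card[OF assms(1)] distinct_card[of ?S] by (simp add: W)
  have "\<not> {1..?N} \<subseteq> price ` set ?S"
  proof
    assume "{1..?N} \<subseteq> price ` set ?S"
    then have "card {1..?N} \<le> card (price ` set ?S)" by (intro card_mono) auto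
    also have "\<dots> \<le> card (set ?S)" by (intro card_image_le) auto
    finally show False using card card_length[of ds] by simp
  qed
  then obtain c where "c \<in> {1..?N}" and c3: "c \<notin> price ` set ?S" by blast
  then have c: "1 \<le> c" "c \<le> ?N" by simp_all
  \<comment> \<open>Unsold vertices have price 0 and \<open>c\<close> is positive, so a level missed
    by the sold vertices is missed by all.\<close>
  then have gap: "price e \<noteq> c" if "e \<in> set es" for e
  proof (cases "holder e = []")
    case True
    then show ?thesis using i(3)[OF that] c(1) by auto
  next
    case False
    then show ?thesis using c3 that by auto
  qed
  text \<open>No price equals \<open>c\<close>. Vertices dearer than \<open>c\<close> are all sold, and a demand adjacent to some
    cheaper vertex holds a cheaper vertex: so only the demands confined to the dear ones keep \<open>Q\<close>.\<close>
  define dear where "dear = fst ` {e \<in> set es. c < price e}"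
  have "{e \<in> set es. c < price e} \<subseteq> set ?S" using i(3) by auto
  then have dear_sold: "dear \<subseteq> set W" unfolding dear_def W set_map by (rule image_mono)
  have held: "\<exists>e\<in>set es. p \<in> set (holder e) \<and> price e < c" if p: "p \<in> set ds" "v \<in> set vs" "adj p v" "v \<notin> dear" for p v
  proof -
    obtain e' where e': "e' \<in> set es" "fst e' = v" using p(2) unfolding i(2)[symmetric] by blast
    have "\<not> c < price e'" using p(4) e' unfolding dear_def by blast
    then have le: "price e' < c" using gap[OF e'(1)] by simp
    \<comment> \<open>A dropped demand sees only prices of at least \<open>?N\<close>. Here
      \<open>p\<close> sees a price below \<open>c \<le> ?N\<close>, so it holds some vertex;
      slackness bounds the price of that vertex by \<open>c\<close>, and the gap rules out
      equality.\<close>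
    have "\<not> ?N \<le> price e'" using le c(2) by simp
    then obtain e where e: "e \<in> set es" "p \<in> set (holder e)"
      using i(6)[OF p(1) _ e'(1)] e'(2) p(3) by blast
    have "price e \<le> c" using i(5)[OF e e'(1)] e'(2) p(3) le by simp
    then have "price e < c" using gap[OF e(1)] by simp
    then show ?thesis using e by blast
  qed
  define M where "M p = fst (SOME e. e \<in> set es \<and> p \<in> set (holder e))" for p
  have M: "M p = fst e" if "e \<in> set es" "p \<in> set (holder e)" for e p
  proof -
    let ?e = "SOME e. e \<in> set es \<and> p \<in> set (holder e)"
    have "?e \<in> set es \<and> p \<in> set (holder ?e)" by (rule someI[of _ e]) (use that in simp)
    then show ?thesis unfolding M_def using i(4)[of ?e e] that by blast
  qed
  have inj: "inj_on fst (set es)" using i(1) by (simp add: distinct_map)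
  fix Q J assume J: "J \<subseteq> set ds" and Q: "inj_on Q J" "\<And>p. p \<in> J \<Longrightarrow> Q p \<in> set vs \<and> adj p (Q p)"
  define conf where "conf p \<longleftrightarrow> (\<forall>v\<in>set vs. adj p v \<longrightarrow> v \<in> dear)" for p
  define Q' where "Q' p = (if conf p then Q p else M p)" for p
  have free: "M p \<in> set W \<and> adj p (M p) \<and> M p \<notin> dear \<and> (\<exists>e\<in>set es. p \<in> set (holder e))"
    if p: "p \<in> J" "\<not> conf p" for p
  proof -
    obtain e where e: "e \<in> set es" "p \<in> set (holder e)" "price e < c"
      using held[of p] p J unfolding conf_def by blast
    have "fst e \<notin> dear"
    proof
      assume "fst e \<in> dear"
      then obtain f where f: "f \<in> set es" "c < price f" "fst f = fst e" unfolding dear_def by auto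
      then have "f = e" by (intro inj_onD[OF inj f(3)] e)
      then show False using e(3) f(2) by simp
    qed
    moreover have "0 < length (holder e)" using e(2) by (cases "holder e") auto
    then have "fst e \<in> set W" using e(1) unfolding W by simp
    moreover have "adj p (fst e)" using i(3)[OF e(1)] e(2) by blast
    ultimately show ?thesis unfolding M[OF e(1,2)] using e(1,2) by blast
  qed
  have "inj_on Q' J"
  proof (rule inj_onI)
    fix p q assume pq: "p \<in> J" "q \<in> J" "Q' p = Q' q"
    \<comment> \<open>Confined demands land in \<open>dear\<close> and all others outside it, so a
      collision can only occur within one kind, where \<open>Q\<close> or the holding relation is
      injective.\<close>
    have conf: "Q p \<in> dear" if "p \<in> J" "conf p" for p using Q(2)[OF that(1)] that(2) by (auto simp: conf_def)
    show "p = q"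
    proof (cases "conf p \<longleftrightarrow> conf q")
      case False
      then consider "conf p" "\<not> conf q" | "\<not> conf p" "conf q" by blast
      then show ?thesis
      proof cases
        case 1
        then show ?thesis using pq(3) conf[OF pq(1)] free[OF pq(2)] by (simp add: Q'_def)
      next
        case 2
        then show ?thesis using pq(3) conf[OF pq(2)] free[OF pq(1)] by (simp add: Q'_def)
      qed
    next
      case same: True
      show ?thesis
      proof (cases "conf p")
        case True
        then have "Q p = Q q" using same pq(3) by (simp add: Q'_def)
        then show ?thesis by (rule inj_onD[OF Q(1) _ pq(1,2)])
      next
        case False
        then obtain e f where ef: "e \<in> set es" "p \<in> set (holder e)" "f \<in> set es" "q \<in> set (holder f)"
          using free[OF pq(1)] free[OF pq(2)] same by blast
        then have "fst e = fst f" using pq False same M by (simp add: Q'_def)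
        then have "e = f" by (intro inj_onD[OF inj _ ef(1,3)])
        moreover have "length (holder e) \<le> 1" using i(3)[OF ef(1)] by blast
        ultimately show ?thesis using ef(2,4) by (cases "holder e") auto
      qed
    qed
  qed
  moreover have "Q' p \<in> set W \<and> adj p (Q' p)" if "p \<in> J" for p
  proof (cases "conf p")
    case True
    then show ?thesis using Q(2)[OF that] dear_sold unfolding conf_def Q'_def by auto
  next
    case False
    then show ?thesis using free[OF that] by (simp add: Q'_def)
  qed
  ultimately show "\<exists>Q'. inj_on Q' J \<and> (\<forall>p\<in>J. Q' p \<in> set W \<and> adj p (Q' p))" by blast
qed


section \<open>Polynomial running time of the auction\<close>

lemma ptime_app2:
  assumes "ptime (\<lambda>p. F (fst p) (snd p))" "ptime f" "ptime g"
  shows "ptime (\<lambda>x. F (f x) (g x))"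
  using ptime_comp[OF assms(1) ptime_Pair[OF assms(2,3)]] by simp

lemma ptime_app3:
  assumes "ptime (\<lambda>p. F (fst p) (fst (snd p)) (snd (snd p)))" "ptime f" "ptime g" "ptime h"
  shows "ptime (\<lambda>x. F (f x) (g x) (h x))"
  using ptime_comp[OF assms(1) ptime_Pair[OF assms(2) ptime_Pair[OF assms(3,4)]]] by simp

lemma ptime_pick:
  fixes adj :: "'a :: enc \<Rightarrow> 'v :: enc \<Rightarrow> bool" and es :: "'a \<Rightarrow> ('v, 'd :: enc) entry list"
  assumes adj: "ptime (\<lambda>p. adj (fst p) (snd p))" and "ptime es"
  shows "ptime (\<lambda>x. pick (adj x) (es x))"
  unfolding pick_def
proof (rule ptime_foldl[where q = "\<lambda>n. n + 2"])
  show "ptime (\<lambda>p. pick_step (adj (fst p)) (fst (snd p)) (snd (snd p)))"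
    unfolding pick_step_def by (intro ptime_intros ptime_app2[OF adj])
  fix x and acc :: "('v, 'd) entry list \<times> ('v, 'd) entry list" and e :: "('v, 'd) entry"
  show "esize (pick_step (adj x) acc e) \<le> esize acc + (esize x + esize e + 2)"
    by (simp add: pick_step_def)
qed (auto intro!: assms ptime_intros poly_bounded_intros monoI)

lemma esize_pick: "esize (fst (pick adj es)) + esize (snd (pick adj es)) = esize es"
proof (induction es rule: rev_induct)
  case (snoc e es)
  then show ?case by (auto simp: pick_def pick_step_def)
qed (simp add: pick_def)

text \<open>A bid only moves demands between the waiting list and the entries; the one additional
  node is the unary price increment.\<close>

lemma esize_auction_step: "esize (auction_step adj N st) \<le> esize st + 1"
proof (cases "fst st")
  case Nil
  then show ?thesis by (simp add: auction_step_def)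
next
  case (Cons p ps)
  let ?es = "snd st"
  show ?thesis
  proof (cases "fst (pick (adj p) ?es)")
    case Nil
    then show ?thesis using Cons by (simp add: auction_step_def bid_def)
  next
    case inner: (Cons b bs)
    have "esize ?es = esize (b # bs) + esize (snd (pick (adj p) ?es))"
      using esize_pick[of "adj p" ?es] inner by simp
    then show ?thesis using Cons inner by (simp add: auction_step_def bid_def)
  qed
qed

lemma ptime_auction:
  fixes adj :: "'a :: enc \<Rightarrow> 'd :: enc \<Rightarrow> 'v :: enc \<Rightarrow> bool"
  assumes adj: "ptime (\<lambda>p. adj (fst p) (fst (snd p)) (snd (snd p)))" and "ptime ds" "ptime vs"
  shows "ptime (\<lambda>x. auction (adj x) (ds x) (vs x))"
  unfolding auction_def
proof (rule ptime_foldl[where q = "\<lambda>n. n + 1"])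
  note comp = ptime_comp[OF assms(2)] ptime_comp[OF assms(3)]
  show "ptime (\<lambda>p. auction_step (adj (fst p)) (Suc (length (ds (fst p)))) (fst (snd p)))"
    unfolding auction_step_def bid_def
    by (intro ptime_intros ptime_case_list ptime_pick ptime_app3[OF adj] comp)
  show "ptime (\<lambda>x. (ds x, map (\<lambda>v. (v, 0 :: nat, [] :: 'd list)) (vs x)))"
    by (intro ptime_intros assms)
  show "ptime (\<lambda>x. replicate (length (ds x)) False @ concat (map (\<lambda>v. replicate (Suc (length (ds x))) False) (vs x)))"
    by (intro ptime_intros assms comp)
  show "esize (auction_step (adj x) (Suc (length (ds x))) st) \<le> esize st + (esize x + esize y + 1)"
    for x and st :: "'d list \<times> ('v, 'd) entry list" and y :: bool
    using esize_auction_step[of "adj x" "Suc (length (ds x))" st] by linarith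
qed (auto intro!: poly_bounded_intros monoI)

lemma ptime_sold:
  fixes es :: "'a :: enc \<Rightarrow> ('v :: enc, 'd :: enc) entry list"
  assumes "ptime es"
  shows "ptime (\<lambda>x. sold (es x))"
  unfolding sold_def by (intro ptime_intros assms)

section \<open>The kernelization algorithm\<close>

text \<open>The default \<open>False\<close> outside the list agrees with \<open>A\<close> and the
  edges, which contain no vertex from \<open>n\<close> on; so lookups are correct without range
  conditions.\<close>

definition entry_at :: "bool list \<Rightarrow> nat \<Rightarrow> bool" where
  "entry_at r v = (case drop v r of [] \<Rightarrow> False | b # bs \<Rightarrow> b)"

definition adjacent :: "bool list list \<Rightarrow> nat \<Rightarrow> nat \<Rightarrow> bool" where
  "adjacent M u v = (case drop u M of [] \<Rightarrow> False | r # rs \<Rightarrow> entry_at r v)"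

definition arc_list :: "bool list list \<Rightarrow> (nat \<times> nat) list" where
  "arc_list M = filter (\<lambda>e. adjacent M (fst e) (snd e)) (List.product [0..<length M] [0..<length M])"

definition mem :: "nat \<Rightarrow> nat list \<Rightarrow> bool" where
  "mem v S = list_ex (\<lambda>u. u = v) S"

text \<open>The edges that pass the test form a greedy maximal matching, of which only the endpoints
  are stored.\<close>

definition cover_step :: "nat list \<Rightarrow> nat \<times> nat \<Rightarrow> nat list" where
  "cover_step S e = (if mem (fst e) S \<or> mem (snd e) S then S else fst e # snd e # S)"

definition cover :: "bool list list \<Rightarrow> nat list" where
  "cover M = foldl cover_step [] (arc_list M)"

definition uncovered :: "bool list list \<Rightarrow> nat list" where
  "uncovered M = filter (\<lambda>v. \<not> mem v (cover M)) [0..<length M]"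

text \<open>
  A demand \<open>(x, y, a)\<close> asks for a vertex outside the cover that can follow \<open>x\<close> and precede \<open>y\<close>
  on a path and whose membership in \<open>A\<close> is \<open>a\<close>; the empty list says that there is no such neighbour.
\<close>

type_synonym demand = "nat list \<times> nat list \<times> bool"

definition demands :: "nat list \<Rightarrow> demand list" where
  "demands S = (let xs = [] # map (\<lambda>s. [s]) S in List.product xs (List.product xs [True, False]))"

definition serves :: "bool list list \<times> bool list \<Rightarrow> demand \<Rightarrow> nat \<Rightarrow> bool" where
  "serves G d v \<longleftrightarrow> list_all (\<lambda>s. adjacent (fst G) s v) (fst d)
     \<and> list_all (\<lambda>s. adjacent (fst G) s v) (fst (snd d)) \<and> entry_at (snd G) v = snd (snd d)"

definition kept :: "bool list list \<times> bool list \<Rightarrow> nat list" where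
  "kept G = cover (fst G) @ sold (snd (auction (serves G) (demands (cover (fst G))) (uncovered (fst G))))"

type_synonym input = "bool list list \<times> bool list \<times> bool list \<times> bool list"

text \<open>Only the lengths of the bit lists \<open>k\<close> and \<open>l\<close> are compared
  with \<open>d\<close>, which avoids binary arithmetic. A number is at least its bit length, so a
  failed test puts it above \<open>d\<close>, which exceeds both bounds that a nonempty packing
  obeys; a passed test bounds the encoding. The fallback is an empty graph asking for 0 paths or 1
  path, a trivial yes or no.\<close>

definition kernel :: "input \<Rightarrow> input" where
  "kernel x = (let G = (fst x, fst (snd x)); k = fst (snd (snd x)); l = snd (snd (snd x));
      d = length (demands (cover (fst x))) in
    if length k \<le> d \<and> length l \<le> d
    then (map (\<lambda>u. map (\<lambda>v. adjacent (fst x) u v) (kept G)) (kept G),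
      map (\<lambda>v. entry_at (fst (snd x)) v) (kept G), k, l)
    else ([], [], (if length k \<le> 0 then [] else [True]), []))"

section \<open>Polynomial running time of the kernelization\<close>

lemma ptime_entry_at: "ptime f \<Longrightarrow> ptime g \<Longrightarrow> ptime (\<lambda>x. entry_at (f x) (g x))"
  unfolding entry_at_def by (intro ptime_intros ptime_case_list)

lemma ptime_adjacent: "ptime f \<Longrightarrow> ptime g \<Longrightarrow> ptime h \<Longrightarrow> ptime (\<lambda>x. adjacent (f x) (g x) (h x))"
proof -
  have "ptime (\<lambda>p. adjacent (fst p) (fst (snd p)) (snd (snd p)))"
    unfolding adjacent_def by (intro ptime_intros ptime_case_list ptime_entry_at)
  then show "ptime f \<Longrightarrow> ptime g \<Longrightarrow> ptime h \<Longrightarrow> ptime (\<lambda>x. adjacent (f x) (g x) (h x))"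
    by (rule ptime_app3)
qed

lemma ptime_mem: "ptime f \<Longrightarrow> ptime g \<Longrightarrow> ptime (\<lambda>x. mem (f x) (g x))"
proof -
  have "ptime (\<lambda>p. mem (fst p) (snd p))"
    unfolding mem_def by (intro ptime_intros)
  then show "ptime f \<Longrightarrow> ptime g \<Longrightarrow> ptime (\<lambda>x. mem (f x) (g x))"
    by (rule ptime_app2)
qed

lemma ptime_cover: "ptime cover"
  unfolding cover_def
proof (rule ptime_foldl[where q = "\<lambda>n. n + 2"])
  show "ptime arc_list"
    unfolding arc_list_def by (intro ptime_intros ptime_adjacent)
  show "ptime (\<lambda>p :: bool list list \<times> nat list \<times> nat \<times> nat. cover_step (fst (snd p)) (snd (snd p)))"
    unfolding cover_step_def by (intro ptime_intros ptime_mem)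
  show "esize (cover_step S e) \<le> esize S + (esize M + esize e + 2)"
    for M :: "bool list list" and S and e :: "nat \<times> nat"
    by (simp add: cover_step_def)
qed (auto intro!: ptime_intros poly_bounded_intros monoI)

lemmas ptime_cover' = ptime_comp[OF ptime_cover]

lemma ptime_demands: "ptime f \<Longrightarrow> ptime (\<lambda>x. demands (f x))"
proof -
  have "ptime demands"
    unfolding demands_def Let_def by (intro ptime_intros)
  then show "ptime f \<Longrightarrow> ptime (\<lambda>x. demands (f x))" by (rule ptime_comp)
qed

lemma ptime_kept: "ptime f \<Longrightarrow> ptime (\<lambda>x. kept (f x))"
proof -
  have "ptime (\<lambda>p. serves (fst p) (fst (snd p)) (snd (snd p)))"
    unfolding serves_def by (intro ptime_intros ptime_adjacent ptime_entry_at)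
  then have "ptime kept"
    unfolding kept_def uncovered_def
    by (intro ptime_intros ptime_sold ptime_auction ptime_demands ptime_mem ptime_cover')
  then show "ptime f \<Longrightarrow> ptime (\<lambda>x. kept (f x))" by (rule ptime_comp)
qed

lemma ptime_kernel: "ptime kernel"
  unfolding kernel_def Let_def
  by (intro ptime_intros ptime_demands ptime_cover' ptime_adjacent ptime_kept ptime_entry_at)


section \<open>Rerouting path packings\<close>

definition packing :: "'a graph \<Rightarrow> 'a set \<Rightarrow> nat \<Rightarrow> 'a list set \<Rightarrow> bool" where
  "packing G A l P \<longleftrightarrow> finite P \<and> (\<forall>p\<in>P. is_A_path G A p \<and> path_length p = l)
     \<and> pairwise (\<lambda>p q. set p \<inter> set q = {}) P"

lemma has_path_packing_iff: "has_path_packing G A k l \<longleftrightarrow> (\<exists>P. packing G A l P \<and> card P = k)"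
  unfolding has_path_packing_def packing_def by blast

text \<open>Lists orient the paths; ordered pairs keep predecessor and successor of a vertex
  apart.\<close>

definition arcs :: "'a list set \<Rightarrow> ('a \<times> 'a) set" where
  "arcs P = {(p ! i, p ! Suc i) | p i. p \<in> P \<and> Suc i < length p}"

text \<open>This transport serves both directions of the equivalence. Edges are only required to be
  preserved along the arcs of \<open>P\<close>, because rerouting need not be a homomorphism of the
  graph.\<close>

lemma packing_map:
  assumes P: "packing G A l P" and inj: "inj_on f (\<Union>p\<in>P. set p)"
    and verts: "\<And>p v. p \<in> P \<Longrightarrow> v \<in> set p \<Longrightarrow> f v \<in> verts H"
    and edges: "\<And>u v. (u, v) \<in> arcs P \<Longrightarrow> {f u, f v} \<in> edges H"
    and A: "\<And>p v. p \<in> P \<Longrightarrow> v \<in> set p \<Longrightarrow> f v \<in> B \<longleftrightarrow> v \<in> A"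
  shows "has_path_packing H B (card P) l"
proof -
  have "packing H B l (map f ` P)"
    unfolding packing_def
  proof (intro conjI ballI)
    show "finite (map f ` P)" using P by (simp add: packing_def)
    show "pairwise (\<lambda>p q. set p \<inter> set q = {}) (map f ` P)"
    proof (rule pairwise_imageI)
      fix p q assume pq: "p \<in> P" "q \<in> P" "p \<noteq> q"
      then have "set p \<inter> set q = {}" using P unfolding packing_def pairwise_def by blast
      moreover have "f ` set p \<inter> f ` set q = f ` (set p \<inter> set q)"
        using inj_on_image_Int[OF inj, of "set p" "set q"] pq by blast
      ultimately show "set (map f p) \<inter> set (map f q) = {}" by simp
    qed
    fix p' assume "p' \<in> map f ` P"
    then obtain p where p: "p \<in> P" "p' = map f p" by blast
    have len: "path_length p = l" and path: "is_A_path G A p" using P p(1) unfolding packing_def by blast+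
    show "path_length p' = l" using len p(2) by (simp add: path_length_def)
    have ne: "p \<noteq> []" and dist: "distinct p" using path unfolding is_A_path_def is_path_def by blast+
    have injp: "inj_on f (set p)" by (rule inj_on_subset[OF inj]) (use p in auto)
    have "is_path H p'"
      unfolding is_path_def successively_conv_nth
    proof (intro conjI allI impI)
      show "p' \<noteq> []" using ne p(2) by simp
      show "distinct p'" using dist injp p(2) by (simp add: distinct_map)
      show "set p' \<subseteq> verts H" using verts p by auto
      fix i assume "Suc i < length p'"
      then have "(p ! i, p ! Suc i) \<in> arcs P" using p unfolding arcs_def by auto
      then show "{p' ! i, p' ! Suc i} \<in> edges H" using edges p(2) \<open>Suc i < length p'\<close> by auto
    qed
    moreover have "hd p' \<in> B" "last p' \<in> B"
      using path A[OF p(1)] ne p(2) unfolding is_A_path_def by (auto simp: hd_map last_map)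
    moreover have "hd p' \<noteq> last p'"
      using path ne p(2) inj_onD[OF injp, of "hd p" "last p"] unfolding is_A_path_def
      by (auto simp: hd_map last_map)
    moreover have "internal_verts p' \<subseteq> verts H - B"
    proof
      fix w assume "w \<in> internal_verts p'"
      then obtain v where v: "v \<in> internal_verts p" "w = f v"
        using p(2) unfolding internal_verts_def by (auto simp: map_tl[symmetric] map_butlast[symmetric])
      have "v \<notin> A" using path v(1) unfolding is_A_path_def by blast
      moreover have "v \<in> set p"
        using v(1) list.set_sel(2)[OF ne] unfolding internal_verts_def by (blast dest: in_set_butlastD)
      ultimately have "v \<in> set p" "v \<notin> A" by blast+
      then show "w \<in> verts H - B" using v(2) verts[OF p(1)] A[OF p(1)] by auto
    qed
    ultimately show "is_A_path H B p'" unfolding is_A_path_def by blast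
  qed
  moreover have "card (map f ` P) = card P"
    by (intro card_image inj_on_mapI inj_on_subset[OF inj]) auto
  ultimately show ?thesis unfolding has_path_packing_iff by blast
qed

lemma packing_same_path:
  assumes "packing G A l P" "p \<in> P" "q \<in> P" "v \<in> set p" "v \<in> set q"
  shows "p = q"
  using assms unfolding packing_def pairwise_def by blast

lemma packing_distinct:
  assumes "packing G A l P" "p \<in> P"
  shows "distinct p"
  using assms unfolding packing_def is_A_path_def is_path_def by blast

text \<open>A vertex lies on only one path of the packing and at only one position of it; the same
  reason gives uniqueness on the left.\<close>

lemma arcs_right_unique:
  assumes P: "packing G A l P" and "(u, v) \<in> arcs P" "(u, w) \<in> arcs P"
  shows "v = w"
proof -
  obtain p i where p: "p \<in> P" "Suc i < length p" "u = p ! i" "v = p ! Suc i"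
    using assms(2) unfolding arcs_def by blast
  obtain q j where q: "q \<in> P" "Suc j < length q" "u = q ! j" "w = q ! Suc j"
    using assms(3) unfolding arcs_def by blast
  have "u \<in> set p" "u \<in> set q" using p q nth_mem[of i p] nth_mem[of j q] by simp_all
  then have "p = q" by (rule packing_same_path[OF P p(1) q(1)])
  moreover from this have "i = j" using p q nth_eq_iff_index_eq[OF packing_distinct[OF P p(1)], of i j] by simp
  ultimately show ?thesis using p q by simp
qed

lemma arcs_left_unique:
  assumes P: "packing G A l P" and "(v, u) \<in> arcs P" "(w, u) \<in> arcs P"
  shows "v = w"
proof -
  obtain p i where p: "p \<in> P" "Suc i < length p" "v = p ! i" "u = p ! Suc i"
    using assms(2) unfolding arcs_def by blast
  obtain q j where q: "q \<in> P" "Suc j < length q" "w = q ! j" "u = q ! Suc j"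
    using assms(3) unfolding arcs_def by blast
  have "u \<in> set p" "u \<in> set q" using p q nth_mem[of "Suc i" p] nth_mem[of "Suc j" q] by simp_all
  then have "p = q" by (rule packing_same_path[OF P p(1) q(1)])
  moreover from this have "i = j"
    using p q nth_eq_iff_index_eq[OF packing_distinct[OF P p(1)], of "Suc i" "Suc j"] by simp
  ultimately show ?thesis using p q by simp
qed

lemma arcs_edges: "packing G A l P \<Longrightarrow> (u, v) \<in> arcs P \<Longrightarrow> {u, v} \<in> edges G"
  unfolding packing_def is_A_path_def is_path_def successively_conv_nth arcs_def by blast

lemma arcs_verts:
  assumes "(u, v) \<in> arcs P"
  shows "u \<in> (\<Union>p\<in>P. set p)" "v \<in> (\<Union>p\<in>P. set p)"
  using assms unfolding arcs_def by (auto intro!: bexI nth_mem)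

text \<open>A path of positive length has at least two vertices: the first one starts an arc, every
  later one ends an arc. Hence each vertex of a packing has a neighbour by which it can be
  identified.\<close>

lemma arcs_cover_verts:
  assumes P: "packing G A l P" and l: "0 < l" and v: "v \<in> (\<Union>p\<in>P. set p)"
  obtains u where "(u, v) \<in> arcs P" | w where "(v, w) \<in> arcs P"
proof -
  obtain p i where p: "p \<in> P" "i < length p" "v = p ! i" using v by (auto simp: in_set_conv_nth)
  have "path_length p = l" using P p(1) unfolding packing_def by blast
  then have "1 < length p" using l unfolding path_length_def by simp
  show thesis
  proof (cases i)
    case 0
    then have "(v, p ! 1) \<in> arcs P" using p \<open>1 < length p\<close> unfolding arcs_def by force
    then show thesis by (rule that(2))
  next
    case (Suc j)
    then have "(p ! j, v) \<in> arcs P" using p unfolding arcs_def by force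
    then show thesis by (rule that(1))
  qed
qed

lemma vertex_cover_edge:
  assumes "vertex_cover G S" "{u, v} \<in> edges G"
  shows "u \<in> S \<or> v \<in> S"
proof -
  have "{u, v} \<inter> S \<noteq> {}" using assms unfolding vertex_cover_def by (elim conjE bspec)
  then show ?thesis by simp
qed

text \<open>The map \<open>f\<close> fixes \<open>S\<close> and sends every other vertex to the one
  that its demand receives from the exchange. An arc has an end in \<open>S\<close>, so a
  replacement only has to fit neighbours that stay. The set \<open>D\<close>, the relation
  \<open>sat\<close> and the exchange property are all that is needed of the auction.\<close>

lemma reroute:
  fixes G :: "'a graph"
  assumes P: "packing G A l P" and l: "0 < l" and S: "vertex_cover G S"
    and W: "W \<inter> S = {}" "W \<subseteq> verts G"
    and exchange: "\<And>Q J. J \<subseteq> D \<Longrightarrow> inj_on Q J \<Longrightarrow> (\<And>d. d \<in> J \<Longrightarrow> Q d \<in> verts G - S \<and> sat d (Q d)) \<Longrightarrow>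
      \<exists>Q'. inj_on Q' J \<and> (\<forall>d\<in>J. Q' d \<in> W \<and> sat d (Q' d))"
    and sat: "\<And>x y a v. sat (x, y, a) v \<longleftrightarrow>
      (\<forall>s\<in>set x. {s, v} \<in> edges G) \<and> (\<forall>s\<in>set y. {s, v} \<in> edges G) \<and> (v \<in> A \<longleftrightarrow> a)"
    and D: "\<And>x y a. (x = [] \<or> (\<exists>s\<in>S. x = [s])) \<Longrightarrow> (y = [] \<or> (\<exists>s\<in>S. y = [s])) \<Longrightarrow> (x, y, a) \<in> D"
  obtains f where "inj_on f (\<Union>p\<in>P. set p)" "\<And>p v. p \<in> P \<Longrightarrow> v \<in> set p \<Longrightarrow> f v \<in> S \<union> W"
    "\<And>u v. (u, v) \<in> arcs P \<Longrightarrow> {f u, f v} \<in> edges G"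
    "\<And>p v. p \<in> P \<Longrightarrow> v \<in> set p \<Longrightarrow> f v \<in> A \<longleftrightarrow> v \<in> A"
proof -
  define U where "U = (\<Union>p\<in>P. set p)"
  have Uv: "U \<subseteq> verts G"
    using P unfolding U_def packing_def is_A_path_def is_path_def by blast
  \<comment> \<open>Lists of length at most one, in the form in which demands store
    neighbours.\<close>
  define pred where "pred v = (if \<exists>u. (u, v) \<in> arcs P then [THE u. (u, v) \<in> arcs P] else [])" for v
  define succ where "succ v = (if \<exists>w. (v, w) \<in> arcs P then [THE w. (v, w) \<in> arcs P] else [])" for v
  have pred: "pred v = [u]" if "(u, v) \<in> arcs P" for u v
  proof -
    have "(THE u. (u, v) \<in> arcs P) = u"
      by (rule the_equality, rule that, rule arcs_left_unique[OF P _ that])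
    moreover have "\<exists>u. (u, v) \<in> arcs P" using that by (rule exI)
    ultimately show ?thesis by (simp only: pred_def if_True)
  qed
  have succ: "succ v = [w]" if "(v, w) \<in> arcs P" for v w
  proof -
    have "(THE w. (v, w) \<in> arcs P) = w"
      by (rule the_equality, rule that, rule arcs_right_unique[OF P _ that])
    moreover have "\<exists>w. (v, w) \<in> arcs P" using that by (rule exI)
    ultimately show ?thesis by (simp only: succ_def if_True)
  qed
  have pred_arc: "(u, v) \<in> arcs P" if "u \<in> set (pred v)" for u v
  proof (cases "\<exists>u. (u, v) \<in> arcs P")
    case True
    then obtain u' where "(u', v) \<in> arcs P" by blast
    then show ?thesis using that pred[of u' v] by simp
  qed (use that in \<open>simp add: pred_def\<close>)
  have succ_arc: "(v, w) \<in> arcs P" if "w \<in> set (succ v)" for v w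
  proof (cases "\<exists>w. (v, w) \<in> arcs P")
    case True
    then obtain w' where "(v, w') \<in> arcs P" by blast
    then show ?thesis using that succ[of v w'] by simp
  qed (use that in \<open>simp add: succ_def\<close>)
  define dem where "dem v = (pred v, succ v, v \<in> A)" for v
  have cov: "u \<in> S \<or> v \<in> S" if "(u, v) \<in> arcs P" for u v
    by (rule vertex_cover_edge[OF S arcs_edges[OF P that]])
  let ?I = "U - S"
  \<comment> \<open>Equal demands share a predecessor or a successor, and that neighbour determines
    the vertex because arcs are unique on both sides.\<close>
  have inj_dem: "inj_on dem ?I"
  proof (rule inj_onI)
    fix v w assume vw: "v \<in> ?I" "w \<in> ?I" "dem v = dem w"
    then have eq: "pred v = pred w" "succ v = succ w" by (auto simp: dem_def)
    have "v \<in> (\<Union>p\<in>P. set p)" using vw(1) U_def by blast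
    from this show "v = w"
    proof (rule arcs_cover_verts[OF P l])
      fix u assume "(u, v) \<in> arcs P"
      then have "(u, w) \<in> arcs P" using pred_arc[of u w] pred[of u v] eq(1) by simp
      with \<open>(u, v) \<in> arcs P\<close> show "v = w" by (rule arcs_right_unique[OF P])
    next
      fix u assume "(v, u) \<in> arcs P"
      then have "(w, u) \<in> arcs P" using succ_arc[of u w] succ[of v u] eq(2) by simp
      with \<open>(v, u) \<in> arcs P\<close> show "v = w" by (rule arcs_left_unique[OF P])
    qed
  qed
  have demD: "dem v \<in> D" if "v \<in> ?I" for v
    unfolding dem_def
  proof (rule D)
    show "pred v = [] \<or> (\<exists>s\<in>S. pred v = [s])"
    proof (cases "\<exists>u. (u, v) \<in> arcs P")
      case True
      then obtain u where u: "(u, v) \<in> arcs P" by blast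
      then have "u \<in> S" using cov[OF u] that by simp
      then show ?thesis unfolding pred[OF u] by simp
    qed (simp add: pred_def)
    show "succ v = [] \<or> (\<exists>s\<in>S. succ v = [s])"
    proof (cases "\<exists>u. (v, u) \<in> arcs P")
      case True
      then obtain u where u: "(v, u) \<in> arcs P" by blast
      then have "u \<in> S" using cov[OF u] that by simp
      then show ?thesis unfolding succ[OF u] by simp
    qed (simp add: succ_def)
  qed
  have dem_sat: "sat (dem v) v" for v
    unfolding dem_def sat
  proof (intro conjI ballI)
    show "{s, v} \<in> edges G" if "s \<in> set (pred v)" for s by (rule arcs_edges[OF P pred_arc[OF that]])
    show "{s, v} \<in> edges G" if "s \<in> set (succ v)" for s
      using arcs_edges[OF P succ_arc[OF that]] by (simp add: insert_commute)
  qed simp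
  \<comment> \<open>The packing itself is the matching to be exchanged: each demand that occurs is
    assigned the vertex from which it arose.\<close>
  let ?Q = "inv_into ?I dem"
  have Q: "?Q (dem v) = v" if "v \<in> ?I" for v using inv_into_f_f[OF inj_dem that] .
  have "\<exists>Q'. inj_on Q' (dem ` ?I) \<and> (\<forall>d\<in>dem ` ?I. Q' d \<in> W \<and> sat d (Q' d))"
  proof (rule exchange)
    show "dem ` ?I \<subseteq> D" using demD by blast
    show "inj_on ?Q (dem ` ?I)" by (rule inj_on_inv_into) simp
    show "?Q d \<in> verts G - S \<and> sat d (?Q d)" if d: "d \<in> dem ` ?I" for d
    proof -
      obtain v where v: "v \<in> ?I" "d = dem v" using d by blast
      then have "?Q d = v" using Q by simp
      then show ?thesis using v dem_sat[of v] Uv by auto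
    qed
  qed
  then obtain Q' where Q': "inj_on Q' (dem ` ?I)" "\<And>v. v \<in> ?I \<Longrightarrow> Q' (dem v) \<in> W"
    "\<And>v. v \<in> ?I \<Longrightarrow> sat (dem v) (Q' (dem v))" by blast
  define f where "f v = (if v \<in> S then v else Q' (dem v))" for v
  show thesis
  proof (rule that[of f])
    show "inj_on f (\<Union>p\<in>P. set p)"
      unfolding U_def[symmetric]
    proof (rule inj_onI)
      fix v w assume vw: "v \<in> U" "w \<in> U" "f v = f w"
      show "v = w"
      proof (cases "v \<in> S"; cases "w \<in> S")
        assume "v \<notin> S" "w \<notin> S"
        then have "Q' (dem v) = Q' (dem w)" using vw(3) by (simp add: f_def)
        then have "dem v = dem w" using vw \<open>v \<notin> S\<close> \<open>w \<notin> S\<close> by (intro inj_onD[OF Q'(1)]) auto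
        then show ?thesis using vw \<open>v \<notin> S\<close> \<open>w \<notin> S\<close> by (intro inj_onD[OF inj_dem]) auto
      next
        assume "v \<in> S" "w \<notin> S"
        then have "f w \<in> W" "f v \<in> S" using vw Q'(2)[of w] by (simp_all add: f_def)
        then show ?thesis using vw(3) W(1) by auto
      next
        assume "v \<notin> S" "w \<in> S"
        then have "f v \<in> W" "f w \<in> S" using vw Q'(2)[of v] by (simp_all add: f_def)
        then show ?thesis using vw(3) W(1) by auto
      qed (use vw in \<open>simp add: f_def\<close>)
    qed
    show "f v \<in> S \<union> W" if "p \<in> P" "v \<in> set p" for p v
    proof (cases "v \<in> S")
      case False
      then have "v \<in> ?I" using that U_def by blast
      from Q'(2)[OF this] show ?thesis using False by (simp add: f_def)
    qed (simp add: f_def)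
    show "f v \<in> A \<longleftrightarrow> v \<in> A" if "p \<in> P" "v \<in> set p" for p v
    proof (cases "v \<in> S")
      case False
      then have "v \<in> ?I" using that U_def by blast
      from Q'(3)[OF this] show ?thesis using False by (simp add: f_def dem_def sat)
    qed (simp add: f_def)
    show "{f u, f v} \<in> edges G" if uv: "(u, v) \<in> arcs P" for u v
    proof -
      have U: "u \<in> U" "v \<in> U" using arcs_verts[OF uv] U_def by auto
      consider "u \<in> S" "v \<in> S" | "u \<in> S" "v \<in> ?I" | "u \<in> ?I" "v \<in> S" using cov[OF uv] U by blast
      then show ?thesis
      proof cases
        case 1
        then show ?thesis using arcs_edges[OF P uv] by (simp add: f_def)
      next
        case 2
        then show ?thesis using Q'(3)[OF 2(2)] pred[OF uv] by (simp add: f_def dem_def sat)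
      next
        case 3
        then show ?thesis using Q'(3)[OF 3(1)] succ[OF uv] by (simp add: f_def dem_def sat insert_commute)
      qed
    qed
  qed
qed

text \<open>Vertices outside \<open>S\<close> are never consecutive, so they outnumber those inside
  by at most one.\<close>

lemma path_length_cover:
  assumes "successively (\<lambda>u v. u \<in> S \<or> v \<in> S) p"
  shows "length p \<le> 2 * length (filter (\<lambda>v. v \<in> S) p) + 1"
  using assms
proof (induction p rule: induct_list012)
  case (3 u v p)
  then show ?case
  proof (cases "u \<in> S")
    case True
    then show ?thesis using 3 by simp
  next
    case False
    then have "v \<in> S" using 3 by simp
    moreover have "successively (\<lambda>u v. u \<in> S \<or> v \<in> S) p" using 3 by (cases p) auto
    ultimately show ?thesis using 3 False by simp
  qed
qed simp_all

text \<open>Distinct ends force \<open>0 < l\<close>. Every path then has an edge and so meets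
  \<open>S\<close>, and disjoint paths meet it in different vertices.\<close>

lemma packing_bounds:
  assumes P: "packing G A l P" and S: "vertex_cover G S" and "finite S" and "P \<noteq> {}"
  shows "0 < l" "l \<le> 2 * card S" "card P \<le> card S"
proof -
  have l: "0 < l \<and> l \<le> 2 * card (set p \<inter> S) \<and> set p \<inter> S \<noteq> {}" if "p \<in> P" for p
  proof -
    have path: "is_A_path G A p" "path_length p = l" using P that unfolding packing_def by blast+
    have len: "0 < l"
    proof (rule ccontr)
      assume "\<not> 0 < l"
      then have "length p \<le> 1" using path(2) by (simp add: path_length_def)
      moreover have "p \<noteq> []" using path(1) unfolding is_A_path_def is_path_def by blast
      ultimately have "hd p = last p" by (cases p) auto
      then show False using path(1) unfolding is_A_path_def by blast
    qed
    have "successively (\<lambda>u v. {u, v} \<in> edges G) p"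
      using path(1) unfolding is_A_path_def is_path_def by blast
    then have "successively (\<lambda>u v. u \<in> S \<or> v \<in> S) p"
      by (rule successively_mono) (rule vertex_cover_edge[OF S])
    then have "length p \<le> 2 * length (filter (\<lambda>v. v \<in> S) p) + 1" by (rule path_length_cover)
    also have "length (filter (\<lambda>v. v \<in> S) p) = card (set p \<inter> S)"
      using distinct_card[OF distinct_filter[OF packing_distinct[OF P that]], of "\<lambda>v. v \<in> S"]
      by (simp add: Int_def conj_commute)
    finally have "l \<le> 2 * card (set p \<inter> S)" using path(2) by (simp add: path_length_def)
    then show ?thesis using len by (cases "set p \<inter> S = {}") simp_all
  qed
  obtain p where p: "p \<in> P" using assms(4) by blast
  show "0 < l" using l[OF p] by blast
  have "card (set p \<inter> S) \<le> card S" by (intro card_mono) (use assms in auto)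
  then show "l \<le> 2 * card S" using l[OF p] by linarith
  let ?g = "\<lambda>p. SOME v. v \<in> set p \<inter> S"
  have g: "?g p \<in> set p \<inter> S" if "p \<in> P" for p
    unfolding some_in_eq using l[OF that] by blast
  show "card P \<le> card S"
  proof (rule card_inj_on_le[where f = ?g])
    show "inj_on ?g P"
    proof (rule inj_onI)
      fix p q assume pq: "p \<in> P" "q \<in> P" "?g p = ?g q"
      then have "?g p \<in> set p" "?g p \<in> set q" using g[OF pq(1)] g[OF pq(2)] by simp_all
      then show "p = q" by (rule packing_same_path[OF P pq(1,2)])
    qed
    show "?g ` P \<subseteq> S" using g by blast
  qed fact
qed


section \<open>Correctness of the kernelization\<close>

lemma mem_iff [simp]: "mem v S \<longleftrightarrow> v \<in> set S"
  by (auto simp: mem_def list_ex_iff)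

lemma drop_map_upt: "v < n \<Longrightarrow> drop v (map f [0..<n]) = f v # map f [Suc v..<n]"
  using upt_conv_Cons[of v n] by (simp add: drop_map)

lemma entry_at_map_upt [simp]: "entry_at (map f [0..<n]) v \<longleftrightarrow> v < n \<and> f v"
  by (cases "v < n") (simp_all add: entry_at_def drop_map_upt)

definition matrix :: "nat graph \<Rightarrow> bool list list" where
  "matrix G = map (\<lambda>u. map (\<lambda>v. {u, v} \<in> edges G) [0..<card (verts G)]) [0..<card (verts G)]"

text \<open>The tree \<open>enc_pp I\<close> as a value of an encodable type, to which the closure
  rules of \<open>ptime\<close> apply; the numbers stay binary, as lists of bits.\<close>

definition as_input :: "pp_instance \<Rightarrow> input" where
  "as_input I = (matrix (pp_graph I), map (\<lambda>u. u \<in> pp_A I) [0..<card (verts (pp_graph I))],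
     bits (pp_k I), bits (pp_l I))"

lemma enc_list_map: "enc_list e (map f xs) = enc_list (\<lambda>x. e (f x)) xs"
  by (induction xs) auto

lemma enc_pp_eq: "enc_pp I = enc (as_input I)"
  by (simp add: enc_pp_def as_input_def matrix_def enc_list_map Defs.enc_nat_def Let_def)

text \<open>For the last claim, each chosen edge adds two vertices, at least one of which lies in
  \<open>C\<close> and is new. Counting only the part of \<open>C\<close> collected so far makes the
  induction go through.\<close>

lemma cover_fold:
  fixes S :: "nat list"
  defines "R \<equiv> \<lambda>es. foldl cover_step [] es"
  shows "\<forall>e\<in>set es. fst e \<in> set (R es) \<or> snd e \<in> set (R es)"
    and "set (R es) \<subseteq> fst ` set es \<union> snd ` set es"
    and "(\<forall>e\<in>set es. fst e \<noteq> snd e) \<longrightarrow> distinct (R es)"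
    and "finite C \<Longrightarrow> (\<forall>e\<in>set es. fst e \<in> C \<or> snd e \<in> C) \<longrightarrow> length (R es) \<le> 2 * card (C \<inter> set (R es))"
proof (induction es rule: rev_induct)
  case (snoc e es)
  have R: "R (es @ [e]) = cover_step (R es) e" by (simp add: R_def)
  {
    case 1
    then show ?case using snoc(1) unfolding R by (auto simp: cover_step_def)
  next
    case 2
    then show ?case using snoc(2) unfolding R by (auto simp: cover_step_def)
  next
    case 3
    then show ?case using snoc(3) unfolding R by (auto simp: cover_step_def)
  next
    case 4
    show ?case
    proof
      assume e: "\<forall>e\<in>set (es @ [e]). fst e \<in> C \<or> snd e \<in> C"
      then have IH: "length (R es) \<le> 2 * card (C \<inter> set (R es))" using snoc(4)[OF 4] by simp
      show "length (R (es @ [e])) \<le> 2 * card (C \<inter> set (R (es @ [e])))"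
      proof (cases "fst e \<in> set (R es) \<or> snd e \<in> set (R es)")
        case True
        then show ?thesis using IH unfolding R by (simp add: cover_step_def)
      next
        case False
        obtain w where w: "w \<in> C" "w = fst e \<or> w = snd e" using e by auto
        have "Suc (card (C \<inter> set (R es))) = card (insert w (C \<inter> set (R es)))"
          using w False by (subst card_insert_disjoint) auto
        also have "\<dots> \<le> card (C \<inter> set (fst e # snd e # R es))"
          using w by (intro card_mono) auto
        finally show ?thesis using IH False unfolding R by (simp add: cover_step_def)
      qed
    qed
  }
qed (simp_all add: R_def)

lemma simple_graph_edge: "simple_graph G \<Longrightarrow> e \<in> edges G \<Longrightarrow> e \<subseteq> verts G \<and> card e = 2"
  unfolding simple_graph_def by (elim conjE bspec)

lemma vertex_cover_number_attained:
  assumes "simple_graph G"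
  obtains C where "vertex_cover G C" "card C = vertex_cover_number G"
proof -
  have "vertex_cover G (verts G)"
    unfolding vertex_cover_def
  proof (intro conjI ballI)
    fix e assume "e \<in> edges G"
    then have "e \<subseteq> verts G" "card e = 2" using simple_graph_edge[OF assms] by blast+
    then show "e \<inter> verts G \<noteq> {}" by (cases "e = {}") (simp_all add: Int_absorb2)
  qed simp
  then have "\<exists>n S. vertex_cover G S \<and> card S = n" by blast
  then have "\<exists>S. vertex_cover G S \<and> card S = vertex_cover_number G"
    unfolding vertex_cover_number_def by (rule LeastI_ex)
  then show thesis using that by blast
qed

lemma length_demands: "length (demands S) = 2 * (length S + 1) ^ 2"
  by (simp add: demands_def Let_def power2_eq_square)

lemma distinct_demands: "distinct S \<Longrightarrow> distinct (demands S)"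
  unfolding demands_def Let_def
  by (intro distinct_product) (auto simp: distinct_map inj_on_def)

lemma demands_memI:
  assumes "x = [] \<or> (\<exists>s\<in>set S. x = [s])" "y = [] \<or> (\<exists>s\<in>set S. y = [s])"
  shows "(x, y, a) \<in> set (demands S)"
  using assms by (cases a) (auto simp: demands_def Let_def)

section \<open>The cover and the kept vertices of a single instance\<close>

locale input_graph =
  fixes G :: "nat graph" and n :: nat and A :: "nat set"
  assumes simple: "simple_graph G" and verts: "verts G = {..<n}" and A_sub: "A \<subseteq> {..<n}"
begin

abbreviation "vec \<equiv> map (\<lambda>u. u \<in> A) [0..<n]"
abbreviation "S \<equiv> cover (matrix G)"
abbreviation "ks \<equiv> kept (matrix G, vec)"
abbreviation "W \<equiv> sold (snd (auction (serves (matrix G, vec)) (demands S) (uncovered (matrix G))))"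

lemma edge_verts: "{u, v} \<in> edges G \<Longrightarrow> u < n \<and> v < n \<and> u \<noteq> v"
proof -
  assume "{u, v} \<in> edges G"
  then have "{u, v} \<subseteq> verts G" "card {u, v} = 2" using simple_graph_edge[OF simple] by blast+
  then show ?thesis using verts by (cases "u = v") auto
qed

lemma length_matrix [simp]: "length (matrix G) = n"
  by (simp add: matrix_def verts)

lemma adjacent_matrix [simp]: "adjacent (matrix G) u v \<longleftrightarrow> {u, v} \<in> edges G"
proof (cases "u < n")
  case True
  then have "adjacent (matrix G) u v \<longleftrightarrow> v < n \<and> {u, v} \<in> edges G"
    by (simp add: adjacent_def matrix_def verts drop_map_upt)
  then show ?thesis using edge_verts[of u v] by blast
next
  case False
  then have "\<not> adjacent (matrix G) u v" by (simp add: adjacent_def matrix_def verts)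
  then show ?thesis using edge_verts[of u v] False by blast
qed

lemma entry_vec [simp]: "entry_at vec v \<longleftrightarrow> v \<in> A"
  using A_sub by auto

lemma set_arc_list: "set (arc_list (matrix G)) = {(u, v). {u, v} \<in> edges G}"
  using edge_verts by (auto simp: arc_list_def)

lemma distinct_S: "distinct S"
proof -
  have "\<forall>e\<in>set (arc_list (matrix G)). fst e \<noteq> snd e"
    using edge_verts unfolding set_arc_list by auto
  then show ?thesis using cover_fold(3)[of "arc_list (matrix G)"] unfolding cover_def by blast
qed

lemma cover_S: "vertex_cover G (set S)"
  unfolding vertex_cover_def
proof (intro conjI ballI)
  have "fst ` set (arc_list (matrix G)) \<union> snd ` set (arc_list (matrix G)) \<subseteq> verts G"
    using edge_verts unfolding set_arc_list verts by auto
  then show "set S \<subseteq> verts G"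
    using cover_fold(2)[of "arc_list (matrix G)"] unfolding cover_def by (rule order_trans[rotated])
  fix e assume e: "e \<in> edges G"
  then have "card e = 2" using simple_graph_edge[OF simple] by blast
  then obtain u v where uv: "e = {u, v}" by (auto simp: card_2_iff)
  then have "(u, v) \<in> set (arc_list (matrix G))" using e by (simp add: set_arc_list)
  from bspec[OF cover_fold(1) this] show "e \<inter> set S \<noteq> {}"
    unfolding cover_def uv by simp
qed

lemma length_S: "length S \<le> 2 * vertex_cover_number G"
proof -
  obtain C where C: "vertex_cover G C" "card C = vertex_cover_number G"
    by (rule vertex_cover_number_attained[OF simple])
  have "C \<subseteq> {..<n}" using C(1) unfolding vertex_cover_def verts by (rule conjunct1)
  then have fin: "finite C" by (rule finite_subset) simp
  have "\<forall>e\<in>set (arc_list (matrix G)). fst e \<in> C \<or> snd e \<in> C"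
    using vertex_cover_edge[OF C(1)] unfolding set_arc_list by auto
  then have "length S \<le> 2 * card (C \<inter> set S)"
    using cover_fold(4)[OF fin, of "arc_list (matrix G)"] unfolding cover_def by blast
  also have "\<dots> \<le> 2 * card C" using fin by (intro mult_le_mono2 card_mono) auto
  finally show ?thesis using C(2) by simp
qed

lemma set_uncovered: "set (uncovered (matrix G)) = verts G - set S"
  by (auto simp: uncovered_def verts)

lemma distinct_uncovered: "distinct (uncovered (matrix G))"
  by (simp add: uncovered_def)

lemma ks_eq: "ks = S @ W"
  by (simp add: kept_def)

lemmas W_props = auction_sold[OF distinct_demands[OF distinct_S] distinct_uncovered,
  where adj = "serves (matrix G, vec)"]

lemma distinct_ks: "distinct ks"
  using distinct_S W_props(1,2) unfolding ks_eq set_uncovered by auto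

lemma set_ks: "set ks \<subseteq> {..<n}"
proof -
  have "set S \<subseteq> verts G" using cover_S unfolding vertex_cover_def by (rule conjunct1)
  then show ?thesis using W_props(2) unfolding ks_eq set_uncovered verts by auto
qed

lemma length_ks: "length ks \<le> length S + 2 * (length S + 1) ^ 2"
  using W_props(3) unfolding ks_eq length_demands by simp

text \<open>Here \<open>sat\<close> becomes \<open>serves\<close>, \<open>D\<close> the list of
  demands over the computed cover, and the exchange property that of the sold vertices.\<close>

lemma packing_rerouted:
  assumes P: "packing G A l P" and "0 < l"
  obtains f where "inj_on f (\<Union>p\<in>P. set p)" "\<And>p v. p \<in> P \<Longrightarrow> v \<in> set p \<Longrightarrow> f v \<in> set ks"
    "\<And>u v. (u, v) \<in> arcs P \<Longrightarrow> {f u, f v} \<in> edges G"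
    "\<And>p v. p \<in> P \<Longrightarrow> v \<in> set p \<Longrightarrow> f v \<in> A \<longleftrightarrow> v \<in> A"
proof (rule reroute[OF P \<open>0 < l\<close> cover_S, where W = "set W" and D = "set (demands S)"
    and sat = "serves (matrix G, vec)"])
  show "set W \<inter> set S = {}" "set W \<subseteq> verts G" using W_props(2) unfolding set_uncovered by auto
  show "\<exists>Q'. inj_on Q' J \<and> (\<forall>d\<in>J. Q' d \<in> set W \<and> serves (matrix G, vec) d (Q' d))"
    if "J \<subseteq> set (demands S)" "inj_on Q J" "\<And>d. d \<in> J \<Longrightarrow> Q d \<in> verts G - set S \<and> serves (matrix G, vec) d (Q d)" for Q J
    using W_props(4)[OF that(1,2)] that(3) unfolding set_uncovered by blast
  show "serves (matrix G, vec) (x, y, a) v \<longleftrightarrow>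
      (\<forall>s\<in>set x. {s, v} \<in> edges G) \<and> (\<forall>s\<in>set y. {s, v} \<in> edges G) \<and> (v \<in> A \<longleftrightarrow> a)" for x y a v
    by (simp add: serves_def list_all_iff del: entry_at_map_upt)
  show "(x, y, a) \<in> set (demands S)"
    if "x = [] \<or> (\<exists>s\<in>set S. x = [s])" "y = [] \<or> (\<exists>s\<in>set S. y = [s])" for x y a
    using that by (rule demands_memI)
  fix f assume f: "inj_on f (\<Union>p\<in>P. set p)" "\<And>p v. p \<in> P \<Longrightarrow> v \<in> set p \<Longrightarrow> f v \<in> set S \<union> set W"
    "\<And>u v. (u, v) \<in> arcs P \<Longrightarrow> {f u, f v} \<in> edges G"
    "\<And>p v. p \<in> P \<Longrightarrow> v \<in> set p \<Longrightarrow> f v \<in> A \<longleftrightarrow> v \<in> A"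
  have "f v \<in> set ks" if "p \<in> P" "v \<in> set p" for p v
    using f(2)[OF that] unfolding ks_eq by simp
  from that[OF f(1) this f(3,4)] show thesis .
qed

end

section \<open>Induced subgraphs, renumbered to have the vertex set \<open>{..<n}\<close> that
  instances require\<close>

definition induced :: "'a graph \<Rightarrow> 'a list \<Rightarrow> nat graph" where
  "induced G xs = \<lparr>verts = {..<length xs},
     edges = {{i, j} | i j. i < length xs \<and> j < length xs \<and> {xs ! i, xs ! j} \<in> edges G}\<rparr>"

definition induced_set :: "'a set \<Rightarrow> 'a list \<Rightarrow> nat set" where
  "induced_set A xs = {i. i < length xs \<and> xs ! i \<in> A}"

lemma induced_edge:
  "{i, j} \<in> edges (induced G xs) \<longleftrightarrow> i < length xs \<and> j < length xs \<and> {xs ! i, xs ! j} \<in> edges G"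
  by (auto simp: induced_def doubleton_eq_iff insert_commute)

lemma simple_induced:
  assumes "simple_graph G"
  shows "simple_graph (induced G xs)"
proof -
  have "e \<subseteq> {..<length xs} \<and> card e = 2" if e: "e \<in> edges (induced G xs)" for e
  proof -
    obtain i j where ij: "e = {i, j}" "i < length xs" "j < length xs" "{xs ! i, xs ! j} \<in> edges G"
      using e unfolding induced_def by auto
    have "card {xs ! i, xs ! j} = 2" using simple_graph_edge[OF assms ij(4)] by blast
    then have "i \<noteq> j" by auto
    then show ?thesis using ij by simp
  qed
  then show ?thesis unfolding simple_graph_def by (simp add: induced_def)
qed

lemma map_conv_nth: "map f xs = map (\<lambda>i. f (xs ! i)) [0..<length xs]"
  by (rule nth_equalityI) simp_all

lemma card_verts_induced [simp]: "card (verts (induced G xs)) = length xs"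
  by (simp add: induced_def)

lemma matrix_induced: "matrix (induced G xs) = map (\<lambda>u. map (\<lambda>v. {u, v} \<in> edges G) xs) xs"
proof -
  have "matrix (induced G xs) = map (\<lambda>i. map (\<lambda>j. {xs ! i, xs ! j} \<in> edges G) [0..<length xs]) [0..<length xs]"
    unfolding matrix_def card_verts_induced by (intro map_cong refl) (simp add: induced_edge)
  also have "\<dots> = map (\<lambda>i. map (\<lambda>v. {xs ! i, v} \<in> edges G) xs) [0..<length xs]"
    by (intro map_cong refl) (rule map_conv_nth[symmetric])
  also have "\<dots> = map (\<lambda>u. map (\<lambda>v. {u, v} \<in> edges G) xs) xs"
    by (rule map_conv_nth[symmetric])
  finally show ?thesis .
qed

lemma vector_induced: "map (\<lambda>i. i \<in> induced_set A xs) [0..<length xs] = map (\<lambda>v. v \<in> A) xs"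
  unfolding map_conv_nth[of _ xs] by (intro map_cong refl) (simp add: induced_set_def)

context input_graph
begin

text \<open>This direction needs no rerouting: as \<open>ks\<close> is distinct, undoing the
  renumbering embeds the packing into \<open>G\<close>.\<close>

lemma induced_packing:
  assumes "has_path_packing (induced G ks) (induced_set A ks) k l"
  shows "has_path_packing G A k l"
proof -
  obtain P where P: "packing (induced G ks) (induced_set A ks) l P" "card P = k"
    using assms unfolding has_path_packing_iff by blast
  have verts_P: "v < length ks" if "p \<in> P" "v \<in> set p" for p v
    using P(1) that unfolding packing_def is_A_path_def is_path_def induced_def by auto
  have "has_path_packing G A (card P) l"
  proof (rule packing_map[OF P(1), where f = "(!) ks"])
    show "inj_on ((!) ks) (\<Union>p\<in>P. set p)"
      using verts_P distinct_ks by (intro inj_on_nth) auto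
    show "ks ! v \<in> verts G" if "p \<in> P" "v \<in> set p" for p v
      using set_ks nth_mem[OF verts_P[OF that]] verts by auto
    show "{ks ! u, ks ! v} \<in> edges G" if "(u, v) \<in> arcs P" for u v
      using arcs_edges[OF P(1) that] by (simp add: induced_edge)
    show "ks ! v \<in> A \<longleftrightarrow> v \<in> induced_set A ks" if "p \<in> P" "v \<in> set p" for p v
      using verts_P[OF that] by (simp add: induced_set_def)
  qed
  then show ?thesis using P(2) by simp
qed

lemma packing_induced:
  assumes "has_path_packing G A k l"
  shows "has_path_packing (induced G ks) (induced_set A ks) k l"
\<comment> \<open>Positivity of \<open>l\<close> comes from a path of the packing; without paths the
  empty packing does.\<close>
proof (cases "k = 0")
  case True
  have "packing (induced G ks) (induced_set A ks) l {}" by (simp add: packing_def)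
  then show ?thesis unfolding has_path_packing_iff using True card.empty by blast
next
  case False
  obtain P where P: "packing G A l P" "card P = k"
    using assms unfolding has_path_packing_iff by blast
  then have "P \<noteq> {}" using False by auto
  from packing_bounds(1)[OF P(1) cover_S _ this] have l: "0 < l" by simp
  obtain f where f: "inj_on f (\<Union>p\<in>P. set p)" "\<And>p v. p \<in> P \<Longrightarrow> v \<in> set p \<Longrightarrow> f v \<in> set ks"
    "\<And>u v. (u, v) \<in> arcs P \<Longrightarrow> {f u, f v} \<in> edges G"
    "\<And>p v. p \<in> P \<Longrightarrow> v \<in> set p \<Longrightarrow> f v \<in> A \<longleftrightarrow> v \<in> A"
    by (rule packing_rerouted[OF P(1) l]) (rule that)
  \<comment> \<open>\<open>g\<close> gives the position of a kept vertex; the packing is rerouted by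
    \<open>f\<close> and then renumbered by \<open>g\<close>.\<close>
  define g where "g = inv_into {..<length ks} ((!) ks)"
  have ks: "(!) ks ` {..<length ks} = set ks" by (auto simp: set_conv_nth)
  have g: "g v < length ks" "ks ! g v = v" if "v \<in> set ks" for v
    using inv_into_into[of v "(!) ks" "{..<length ks}"] f_inv_into_f[of v "(!) ks" "{..<length ks}"] that
    unfolding g_def ks by auto
  have "has_path_packing (induced G ks) (induced_set A ks) (card P) l"
  proof (rule packing_map[OF P(1), where f = "g \<circ> f"])
    show "inj_on (g \<circ> f) (\<Union>p\<in>P. set p)"
    proof (rule comp_inj_on[OF f(1)], rule inj_on_inverseI)
      show "ks ! g v = v" if "v \<in> f ` (\<Union>p\<in>P. set p)" for v
        using g(2) f(2) that by blast
    qed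
    show "(g \<circ> f) v \<in> verts (induced G ks)" if "p \<in> P" "v \<in> set p" for p v
      using g(1)[OF f(2)[OF that]] by (simp add: induced_def)
    show "{(g \<circ> f) u, (g \<circ> f) v} \<in> edges (induced G ks)" if uv: "(u, v) \<in> arcs P" for u v
    proof -
      have "f u \<in> set ks" "f v \<in> set ks" using arcs_verts[OF uv] f(2) by auto
      then show ?thesis using g f(3)[OF uv] by (simp add: induced_edge)
    qed
    show "(g \<circ> f) v \<in> induced_set A ks \<longleftrightarrow> v \<in> A" if "p \<in> P" "v \<in> set p" for p v
      using g[OF f(2)[OF that]] f(4)[OF that] by (simp add: induced_set_def)
  qed
  then show ?thesis using P(2) by simp
qed

lemma packing_bounds_demands:
  assumes "has_path_packing G A k l" "0 < k"
  shows "k \<le> length (demands S)" "l \<le> length (demands S)"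
proof -
  obtain P where P: "packing G A l P" "card P = k"
    using assms(1) unfolding has_path_packing_iff by blast
  then have "P \<noteq> {}" using assms(2) by auto
  from packing_bounds[OF P(1) cover_S _ this]
  have "l \<le> 2 * length S" "k \<le> length S" using P(2) distinct_card[OF distinct_S] by auto
  moreover have "2 * length S \<le> length (demands S)"
    unfolding length_demands by (simp add: power2_eq_square)
  ultimately show "k \<le> length (demands S)" "l \<le> length (demands S)" by linarith+
qed

end

text \<open>The counterpart of \<open>kernel\<close> on graphs. Equivalence and size are proved for
  this form, the running time for \<open>kernel\<close>, and \<open>as_input_kernel\<close> links
  the two.\<close>

definition kernel_instance :: "pp_instance \<Rightarrow> pp_instance" where
  "kernel_instance I = (let G = pp_graph I; M = matrix G;
      ks = kept (M, map (\<lambda>u. u \<in> pp_A I) [0..<card (verts G)]); d = length (demands (cover M)) in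
    if length (bits (pp_k I)) \<le> d \<and> length (bits (pp_l I)) \<le> d
    then \<lparr>pp_graph = induced G ks, pp_A = induced_set (pp_A I) ks, pp_k = pp_k I, pp_l = pp_l I\<rparr>
    else \<lparr>pp_graph = \<lparr>verts = {}, edges = {}\<rparr>, pp_A = {}, pp_k = (if pp_k I = 0 then 0 else 1), pp_l = 0\<rparr>)"

lemma length_bits_le: "length (bits n) \<le> n"
proof (induction n rule: less_induct)
  case (less n)
  show ?case
  proof (cases "n = 0")
    case False
    then show ?thesis using less[of "n div 2"] by (subst bits.simps) simp
  qed (simp add: bits.simps)
qed

lemma bits_0 [simp]: "bits 0 = []"
  by (simp add: bits.simps)

lemma bits_1: "bits (Suc 0) = [True]"
  by (simp add: bits.simps)

lemma bits_eq_Nil [simp]: "bits n = [] \<longleftrightarrow> n = 0"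
  by (subst bits.simps) simp

lemma input_graphI:
  assumes "I \<in> pp_instances"
  shows "input_graph (pp_graph I) (card (verts (pp_graph I))) (pp_A I)"
  using assms unfolding pp_instances_def input_graph_def by auto

lemma as_input_kernel:
  assumes "I \<in> pp_instances"
  shows "as_input (kernel_instance I) = kernel (as_input I)"
proof -
  interpret input_graph "pp_graph I" "card (verts (pp_graph I))" "pp_A I"
    by (rule input_graphI[OF assms])
  let ?d = "length (demands (cover (matrix (pp_graph I))))"
  show ?thesis
  proof (cases "length (bits (pp_k I)) \<le> ?d \<and> length (bits (pp_l I)) \<le> ?d")
    case True
    then have "kernel_instance I = \<lparr>pp_graph = induced (pp_graph I) ks, pp_A = induced_set (pp_A I) ks,
        pp_k = pp_k I, pp_l = pp_l I\<rparr>"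
      by (simp add: kernel_instance_def Let_def)
    moreover have "kernel (as_input I) = (map (\<lambda>u. map (\<lambda>v. {u, v} \<in> edges (pp_graph I)) ks) ks,
        map (\<lambda>v. v \<in> pp_A I) ks, bits (pp_k I), bits (pp_l I))"
      using True by (simp add: as_input_def kernel_def Let_def del: entry_at_map_upt)
    ultimately show ?thesis
      by (simp add: as_input_def matrix_induced vector_induced)
  next
    case False
    then show ?thesis
      by (auto simp: kernel_instance_def as_input_def kernel_def Let_def matrix_def bits_1)
  qed
qed

lemma kernel_instance_in: 
  assumes "I \<in> pp_instances"
  shows "kernel_instance I \<in> pp_instances"
proof -
  interpret input_graph "pp_graph I" "card (verts (pp_graph I))" "pp_A I"
    by (rule input_graphI[OF assms])
  show ?thesis
    using simple_induced[OF simple]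
    by (auto simp: kernel_instance_def Let_def pp_instances_def induced_set_def) (auto simp: induced_def simple_graph_def)
qed

lemma kernel_instance_yes:
  assumes "I \<in> pp_instances"
  shows "has_path_packing (pp_graph (kernel_instance I)) (pp_A (kernel_instance I))
      (pp_k (kernel_instance I)) (pp_l (kernel_instance I))
    \<longleftrightarrow> has_path_packing (pp_graph I) (pp_A I) (pp_k I) (pp_l I)"
proof -
  interpret input_graph "pp_graph I" "card (verts (pp_graph I))" "pp_A I"
    by (rule input_graphI[OF assms])
  let ?d = "length (demands (cover (matrix (pp_graph I))))"
  show ?thesis
  proof (cases "length (bits (pp_k I)) \<le> ?d \<and> length (bits (pp_l I)) \<le> ?d")
    case True
    then show ?thesis using induced_packing packing_induced by (auto simp: kernel_instance_def Let_def)
  next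
    case False
    have empty: "has_path_packing H B 0 l" for H :: "nat graph" and B l
    proof -
      have "packing H B l {}" by (simp add: packing_def)
      then show ?thesis unfolding has_path_packing_iff using card.empty by blast
    qed
    have none: "\<not> has_path_packing \<lparr>verts = {} :: nat set, edges = {}\<rparr> {} (Suc 0) 0"
    proof
      assume "has_path_packing \<lparr>verts = {} :: nat set, edges = {}\<rparr> {} (Suc 0) 0"
      then obtain P where P: "packing \<lparr>verts = {} :: nat set, edges = {}\<rparr> {} 0 P" "card P = Suc 0"
        unfolding has_path_packing_iff by blast
      then obtain p where "p \<in> P" by fastforce
      then show False using P(1) unfolding packing_def is_A_path_def by blast
    qed
    have "\<not> has_path_packing (pp_graph I) (pp_A I) (pp_k I) (pp_l I)" if "0 < pp_k I"
    proof
      assume "has_path_packing (pp_graph I) (pp_A I) (pp_k I) (pp_l I)"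
      from packing_bounds_demands[OF this that] False
      show False using length_bits_le[of "pp_k I"] length_bits_le[of "pp_l I"] by linarith
    qed
    then show ?thesis using False empty none
      by (cases "pp_k I = 0") (auto simp: kernel_instance_def Let_def)
  qed
qed


section \<open>Running time and size of the kernel\<close>

text \<open>The case \<open>b = 0\<close>, since \<open>computes\<close> uses variable 0 for input
  and output.\<close>

lemma ptime_computes:
  assumes "ptime f"
  obtains c k where "\<And>x. \<exists>t. t \<le> (esize x + 2) ^ k \<and> computes c (enc x) (enc (f x)) t"
proof -
  obtain k where "\<forall>b. \<exists>c. \<forall>s x. s b = enc x \<longrightarrow>
     (\<exists>t s'. exec c s t s' \<and> t \<le> (esize x + 2) ^ k \<and> s' b = enc (f x) \<and> (\<forall>i<b. s' i = s i))"
    using assms unfolding ptime_def by blast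
  then obtain c where c: "\<And>s x. s 0 = enc x \<Longrightarrow>
     \<exists>t s'. exec c s t s' \<and> t \<le> (esize x + 2) ^ k \<and> s' 0 = enc (f x)"
    by meson
  have "\<exists>t. t \<le> (esize x + 2) ^ k \<and> computes c (enc x) (enc (f x)) t" for x
    using c[of "(\<lambda>_. Leaf)(0 := enc x)" x] unfolding computes_def by auto
  then show thesis by (rule that)
qed

lemma poly_time_kernel_instance: "poly_time_on pp_instances enc_pp enc_pp kernel_instance"
proof -
  obtain c k where c: "\<And>x. \<exists>t. t \<le> (esize x + 2) ^ k \<and> computes c (enc x) (enc (kernel x)) t"
    by (rule ptime_computes[OF ptime_kernel]) (rule that)
  \<comment> \<open>\<open>[:2, 1:]\<close> is the polynomial \<open>x + 2\<close>, so the time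
    bound of \<open>ptime\<close> is literally polynomial.\<close>
  have poly: "poly ([:2, 1:] ^ k) m = (m + 2) ^ k" for m :: nat
    by (simp add: poly_power add.commute)
  have "\<exists>t. t \<le> poly ([:2, 1:] ^ k) (size (enc_pp I)) \<and> computes c (enc_pp I) (enc_pp (kernel_instance I)) t"
    if "I \<in> pp_instances" for I
    using c[of "as_input I"] unfolding poly enc_pp_eq as_input_kernel[OF that] .
  then show ?thesis unfolding poly_time_on_def by blast
qed

lemma bits_power2: "bits (2 ^ m) = replicate m False @ [True]"
proof (induction m)
  case (Suc m)
  then show ?case by (subst bits.simps) simp
qed (simp add: bits_1)

lemma less_power_length_bits: "n < 2 ^ length (bits n)"
proof (induction n rule: less_induct)
  case (less n)
  show ?case
  proof (cases "n = 0")
    case False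
    then have "n div 2 < 2 ^ length (bits (n div 2))" using less by simp
    moreover have "length (bits n) = Suc (length (bits (n div 2)))" using False by (subst bits.simps) simp
    ultimately show ?thesis by simp
  qed simp
qed

text \<open>A power of two avoids binary multiplication. If \<open>n\<close> has \<open>b\<close>
  bits, then \<open>n + 2 \<le> 2 ^ (b + 1)\<close>, so \<open>2 ^ (k * (b + 1))\<close> suffices;
  with the least bit first it is written as \<open>k\<close> zeros for every bit of
  \<open>n\<close>, \<open>k\<close> further zeros and a one.\<close>

lemma poly_bounded_computable:
  assumes "poly_bounded f"
  obtains g where "computable g" "\<And>n. f n \<le> g n"
proof -
  obtain k where k: "\<And>n. f n \<le> (n + 2) ^ k" using assms unfolding poly_bounded_def by auto
  define g :: "nat \<Rightarrow> nat" where "g n = 2 ^ (k * (length (bits n) + 1))" for n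
  define h where "h bs = concat (map (\<lambda>b :: bool. replicate k False) bs) @ replicate k False @ [True]" for bs
  have "concat (map (\<lambda>b :: bool. replicate k False) bs) = replicate (length bs * k) False" for bs
    by (induction bs) (simp_all add: replicate_add)
  then have h: "h (bits n) = bits (g n)" for n
    unfolding h_def g_def bits_power2
    by (simp add: replicate_add[symmetric] append_assoc[symmetric] algebra_simps del: append_assoc)
  have "ptime h"
    unfolding h_def by (intro ptime_intros)
  then obtain c j where c: "\<And>x. \<exists>t. t \<le> (esize x + 2) ^ j \<and> computes c (enc x) (enc (h x)) t"
    by (rule ptime_computes) (rule that)
  have enc: "Defs.enc_nat n = enc (bits n)" for n by (simp add: Defs.enc_nat_def)
  have "computable g"
    unfolding computable_def enc using c h by metis
  moreover have "f n \<le> g n" for n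
  proof -
    have "n + 2 \<le> 2 ^ (length (bits n) + 1)" using less_power_length_bits[of n] by simp
    then have "(n + 2) ^ k \<le> (2 ^ (length (bits n) + 1)) ^ k" by (rule power_mono) simp
    also have "\<dots> = g n" unfolding g_def by (simp only: power_mult[symmetric] mult.commute)
    finally show ?thesis using k[of n] by simp
  qed
  ultimately show thesis by (rule that)
qed

text \<open>The bound of \<open>length_ks\<close> with \<open>2 * v\<close> in place of
  \<open>length S\<close>.\<close>

definition kernel_order :: "nat \<Rightarrow> nat" where
  "kernel_order v = 2 * v + 2 * (2 * v + 1) ^ 2"

lemma size_enc_bools: "size (enc_list enc_bool bs) \<le> 2 * length bs"
proof (induction bs)
  case (Cons b bs)
  then show ?case by (cases b) auto
qed simp

lemma size_enc_rows: "\<forall>r\<in>set rs. length r \<le> m \<Longrightarrow> size (enc_list (enc_list enc_bool) rs) \<le> length rs * (2 * m + 1)"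
proof (induction rs)
  case (Cons r rs)
  then show ?case using size_enc_bools[of r] by simp
qed simp

lemma card_kernel_instance:
  assumes "I \<in> pp_instances"
  shows "card (verts (pp_graph (kernel_instance I))) \<le> kernel_order (vertex_cover_number (pp_graph I))"
proof -
  interpret input_graph "pp_graph I" "card (verts (pp_graph I))" "pp_A I"
    by (rule input_graphI[OF assms])
  have "length ks \<le> kernel_order (vertex_cover_number (pp_graph I))"
    using length_ks length_S unfolding kernel_order_def
    by (meson add_le_mono add_le_mono1 le_trans mult_le_mono2 power_mono zero_le)
  then show ?thesis by (simp add: kernel_instance_def Let_def)
qed

text \<open>A bit costs at most two nodes. The matrix gives \<open>m * (2 * m + 1)\<close>; the
  vector for \<open>A\<close> and the two numbers give \<open>6 * m\<close>. Three nodes join the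
  components, and the fallback with \<open>k = 1\<close> takes two more for its single bit, hence
  5.\<close>

lemma size_kernel_instance:
  assumes "I \<in> pp_instances"
  defines "m \<equiv> kernel_order (vertex_cover_number (pp_graph I))"
  shows "size (enc_pp (kernel_instance I)) \<le> m * (2 * m + 1) + 6 * m + 5"
proof -
  interpret input_graph "pp_graph I" "card (verts (pp_graph I))" "pp_A I"
    by (rule input_graphI[OF assms(1)])
  let ?d = "length (demands S)"
  have "?d \<le> 2 * (2 * vertex_cover_number (pp_graph I) + 1) ^ 2"
    unfolding length_demands using length_S by (intro mult_le_mono2 power_mono) auto
  then have d: "?d \<le> m" unfolding m_def kernel_order_def by simp
  show ?thesis
  proof (cases "length (bits (pp_k I)) \<le> ?d \<and> length (bits (pp_l I)) \<le> ?d")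
    case True
    then have eq: "kernel_instance I = \<lparr>pp_graph = induced (pp_graph I) ks, pp_A = induced_set (pp_A I) ks,
        pp_k = pp_k I, pp_l = pp_l I\<rparr>"
      by (simp add: kernel_instance_def Let_def)
    have ks: "length ks \<le> m" using card_kernel_instance[OF assms(1)] unfolding m_def eq by simp
    have "size (enc_list (enc_list enc_bool) (matrix (induced (pp_graph I) ks))) \<le> length ks * (2 * length ks + 1)"
      using size_enc_rows[of "matrix (induced (pp_graph I) ks)" "length ks"] by (simp add: matrix_induced)
    also have "\<dots> \<le> m * (2 * m + 1)" using ks by (intro mult_mono) auto
    finally have M: "size (enc_list (enc_list enc_bool) (matrix (induced (pp_graph I) ks))) \<le> m * (2 * m + 1)" .
    have V: "size (enc_list enc_bool (map (\<lambda>v. v \<in> pp_A I) ks)) \<le> 2 * m"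
      using size_enc_bools[of "map (\<lambda>v. v \<in> pp_A I) ks"] ks by simp
    have "size (enc_list enc_bool (bits (pp_k I))) \<le> 2 * m" "size (enc_list enc_bool (bits (pp_l I))) \<le> 2 * m"
      using size_enc_bools[of "bits (pp_k I)"] size_enc_bools[of "bits (pp_l I)"] True d by linarith+
    then show ?thesis using M V by (simp add: enc_pp_eq eq as_input_def vector_induced)
  next
    case False
    then show ?thesis
      by (auto simp: enc_pp_eq kernel_instance_def Let_def as_input_def matrix_def bits_1)
  qed
qed

lemma kernelization_kernel_instance: "kernelization path_packing_by_vc kernel_instance"
proof -
  have "poly_bounded (\<lambda>v. kernel_order v * (2 * kernel_order v + 1) + 6 * kernel_order v + 5)"
    unfolding kernel_order_def by (intro poly_bounded_intros)
  then obtain g where "computable g"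
    "\<And>v. kernel_order v * (2 * kernel_order v + 1) + 6 * kernel_order v + 5 \<le> g v"
    by (rule poly_bounded_computable) (rule that)
  then have "\<exists>g. computable g \<and> (\<forall>I\<in>pp_instances. size (enc_pp (kernel_instance I)) \<le> g (vertex_cover_number (pp_graph I)))"
    using size_kernel_instance by (meson le_trans)
  then show ?thesis
    unfolding kernelization_def path_packing_by_vc_def
    using poly_time_kernel_instance kernel_instance_in kernel_instance_yes by simp
qed

theorem theorem4:
  "\<exists>K. kernelization path_packing_by_vc K
     \<and> (\<exists>f :: nat \<Rightarrow> real. f \<in> O(\<lambda>n. real n ^ 2)
         \<and> (\<forall>I\<in>pp_instances.
              real (card (verts (pp_graph (K I)))) \<le> f (vertex_cover_number (pp_graph I))))"
proof (intro exI conjI ballI)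
  show "kernelization path_packing_by_vc kernel_instance"
    by (rule kernelization_kernel_instance)
  show "(\<lambda>v. real (kernel_order v)) \<in> O(\<lambda>n. real n ^ 2)"
  \<comment> \<open>The order expands to \<open>8 * v ^ 2 + 10 * v + 2\<close>, and 20 is the sum of
    these coefficients, which suffices from \<open>v = 1\<close> on.\<close>
  proof (rule bigoI[of _ 20], rule eventually_sequentiallyI[of 1])
    fix v :: nat assume "1 \<le> v"
    then have "v \<le> v * v" "1 \<le> v * v" by simp_all
    moreover have "kernel_order v = 8 * (v * v) + 10 * v + 2"
      by (simp add: kernel_order_def power2_eq_square algebra_simps)
    ultimately have "kernel_order v \<le> 20 * (v * v)" by linarith
    then have "real (kernel_order v) \<le> real (20 * (v * v))" by (simp only: of_nat_le_iff)
    then show "norm (real (kernel_order v)) \<le> 20 * norm (real v ^ 2)" by (simp add: power2_eq_square)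
  qed
  fix I assume "I \<in> pp_instances"
  then show "real (card (verts (pp_graph (kernel_instance I)))) \<le> real (kernel_order (vertex_cover_number (pp_graph I)))"
    using card_kernel_instance by simp
qed

end
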